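(* The elements $E_\alpha^\ell$ and $F_\alpha^\ell$ (for $\alpha$ ranging over the six positive roots, i.e. $E_\alpha\in\{E_1,E_{1112},E_{112},E_{11212},E_{12},E_2\}$ and $F_\alpha\in\{F_1,F_{1112},F_{112},F_{11212},F_{12},F_2\}$), together with $\omega_k^\ell-1$ and $(\omega_k')^\ell-1$ ($k=1,2$), are central in $U_{r,s}(G_2)$.
   Context: $\mathbb{K}$ is a field of characteristic $0$; $r\in\mathbb K$ is a primitive $d$th root of unity, $s\in\mathbb K$ is a primitive $d'$th root of unity, $\ell=\mathrm{lcm}(d,d')$, and $\mathbb K$ contains a primitive $\ell$th root of unity. It is assumed that $r^3\neq s^3$, $r^4\neq s^4$ and $r^2-rs+s^2\neq0$. Put $r_1=r$, $s_1=s$, $r_2=r^3$, $s_2=s^3$, and $\langle\omega_1',\omega_1\rangle=rs^{-1}$, $\langle\omega_1',\omega_2\rangle=r^{-3}$, $\langle\omega_2',\omega_1\rangle=s^3$, $\langle\omega_2',\omega_2\rangle=r^3s^{-3}$. $U_{r,s}(G_2)$ is the unital associative $\mathbb{K}$-algebra generated by $e_i,f_i,\omega_i^{\pm1},\omega_i'^{\pm1}$ ($i=1,2$) with relations: (G1) all $\omega_i^{\pm1},\omega_j'^{\pm1}$ commute with each other, and $\omega_i\omega_i^{-1}=1=\omega_j'\omega_j'^{-1}$; (G2) $\omega_je_i\omega_j^{-1}=\langle\omega_i',\omega_j\rangle e_i$, $\omega_jf_i\omega_j^{-1}=\langle\omega_i',\omega_j\rangle^{-1}f_i$; (G3) $\omega_j'e_i\omega_j'^{-1}=\langle\omega_j',\omega_i\rangle^{-1}e_i$,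 $\omega_j'f_i\omega_j'^{-1}=\langle\omega_j',\omega_i\rangle f_i$; (G4) $e_if_j-f_je_i=\delta_{ij}\frac{\omega_i-\omega_i'}{r_i-s_i}$; (G5) $e_2^2e_1-(r^{-3}+s^{-3})e_2e_1e_2+(rs)^{-3}e_1e_2^2=0$ and $e_1^4e_2-(r+s)(r^2+s^2)e_1^3e_2e_1+rs(r^2+s^2)(r^2+rs+s^2)e_1^2e_2e_1^2-(rs)^3(r+s)(r^2+s^2)e_1e_2e_1^3+(rs)^6e_2e_1^4=0$; (G6) $f_1f_2^2-(r^{-3}+s^{-3})f_2f_1f_2+(rs)^{-3}f_2^2f_1=0$ and $f_2f_1^4-(r+s)(r^2+s^2)f_1f_2f_1^3+rs(r^2+s^2)(r^2+rs+s^2)f_1^2f_2f_1^2-(rs)^3(r+s)(r^2+s^2)f_1^3f_2f_1+(rs)^6f_1^4f_2=0$. Quantum root vectors: $E_1=e_1$, $E_2=e_2$, $E_{12}=e_1e_2-s^3e_2e_1$, $E_{112}=e_1E_{12}-rs^2E_{12}e_1$, $E_{1112}=e_1E_{112}-r^2sE_{112}e_1$, $E_{11212}=E_{112}E_{12}-r^2sE_{12}E_{112}$; $F_1=f_1$, $F_2=f_2$, $F_{12}=f_2f_1-r^3f_1f_2$, $F_{112}=F_{12}f_1-r^2sf_1F_{12}$, $F_{1112}=F_{112}f_1-rs^2f_1F_{112}$, $F_{11212}=F_{12}F_{112}-rs^2F_{112}F_{12}$. *)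

theory Defs
  imports "HOL-Library.Poly_Mapping" "HOL-Algebra.Algebraic_Closure_Type"
begin

section \<open>Free associative algebras\<close>

datatype 'x free_mon = Free_Mon "'x list"

instantiation free_mon :: (type) monoid_add
begin

definition zero_free_mon :: "'x free_mon" where
  "zero_free_mon = Free_Mon []"

fun plus_free_mon :: "'x free_mon \<Rightarrow> 'x free_mon \<Rightarrow> 'x free_mon" where
  "plus_free_mon (Free_Mon u) (Free_Mon v) = Free_Mon (u @ v)"

instance
proof
  fix a b c :: "'x free_mon"
  show "a + b + c = a + (b + c)" by (cases a; cases b; cases c) simp
  show "0 + a = a" by (cases a) (simp add: zero_free_mon_def)
  show "a + 0 = a" by (cases a) (simp add: zero_free_mon_def)
qed

end

text \<open>The free unital associative algebra on \<open>'x\<close> over \<open>'k\<close> is the monoid algebra of the free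
  monoid: finitely supported functions on words, with the convolution product supplied by
  \<^theory>\<open>HOL-Library.Poly_Mapping\<close>.\<close>

type_synonym ('x, 'k) free_alg = "'x free_mon \<Rightarrow>\<^sub>0 'k"

definition var :: "'x \<Rightarrow> ('x, 'k::field) free_alg" where
  "var x = Poly_Mapping.single (Free_Mon [x]) 1"

definition scale_free :: "'k::field \<Rightarrow> ('x, 'k) free_alg \<Rightarrow> ('x, 'k) free_alg"
    (infixr \<open>\<cdot>\<close> 75) where
  "c \<cdot> p = Poly_Mapping.single 0 c * p"

abbreviation free_ring :: "('x, 'k::field) free_alg ring" where
  "free_ring \<equiv> ring_of_type_algebra"

lemma ring_free_ring: "ring (free_ring :: ('x, 'k::field) free_alg ring)"
proof -
  have "\<exists>y. x + y = 0" for x :: "('x, 'k) free_alg"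
    using add.right_inverse by blast
  then show ?thesis
    unfolding ring_of_type_algebra_def
    by unfold_locales (auto simp: algebra_simps Units_def add_eq_0_iff2)
qed

section \<open>Rings and roots of unity\<close>

definition ring_center :: "('a, 'm) ring_scheme \<Rightarrow> 'a set" where
  "ring_center R = {z \<in> carrier R. \<forall>x \<in> carrier R. z \<otimes>\<^bsub>R\<^esub> x = x \<otimes>\<^bsub>R\<^esub> z}"

definition primitive_root_of_unity :: "nat \<Rightarrow> 'k::field \<Rightarrow> bool" where
  "primitive_root_of_unity n x \<longleftrightarrow> n > 0 \<and> x ^ n = 1 \<and> (\<forall>k. 0 < k \<and> k < n \<longrightarrow> x ^ k \<noteq> 1)"

section \<open>The two-parameter quantum group of type \<open>G\<^sub>2\<close>\<close>

datatype idx = I1 | I2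

text \<open>\<open>W i\<close> and \<open>W' i\<close> stand for \<open>\<omega>\<^sub>i\<close> and \<open>\<omega>\<^sub>i'\<close>, and \<open>Winv i\<close>, \<open>W'inv i\<close> for their inverses.\<close>

datatype gen = E idx | F idx | W idx | Winv idx | W' idx | W'inv idx

definition torus_gens :: "gen set" where
  "torus_gens = range W \<union> range Winv \<union> range W' \<union> range W'inv"

text \<open>The parameters \<open>r\<^sub>i\<close> (from \<open>r\<close>) and \<open>s\<^sub>i\<close> (from \<open>s\<close>).\<close>

fun param :: "'k::field \<Rightarrow> idx \<Rightarrow> 'k" where
  "param q I1 = q"
| "param q I2 = q ^ 3"

text \<open>\<open>pairing r s i j\<close> is \<open>\<langle>\<omega>\<^sub>i', \<omega>\<^sub>j\<rangle>\<close>: the first index belongs to the primed generator.\<close>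

fun pairing :: "'k::field \<Rightarrow> 'k \<Rightarrow> idx \<Rightarrow> idx \<Rightarrow> 'k" where
  "pairing r s I1 I1 = r * inverse s"
| "pairing r s I1 I2 = inverse (r ^ 3)"
| "pairing r s I2 I1 = s ^ 3"
| "pairing r s I2 I2 = r ^ 3 * inverse (s ^ 3)"

text \<open>A relation \<open>p = q\<close> is represented by the element \<open>p - q\<close> of the free algebra.\<close>

definition rels_G1 :: "(gen, 'k::field) free_alg set" where
  "rels_G1 =
     {var x * var y - var y * var x |x y. x \<in> torus_gens \<and> y \<in> torus_gens}
   \<union> {var (W i) * var (Winv i) - 1 |i. True}
   \<union> {var (W' i) * var (W'inv i) - 1 |i. True}"

definition rels_G2 :: "'k::field \<Rightarrow> 'k \<Rightarrow> (gen, 'k) free_alg set" where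
  "rels_G2 r s =
     {var (W j) * var (E i) * var (Winv j) - pairing r s i j \<cdot> var (E i) |i j. True}
   \<union> {var (W j) * var (F i) * var (Winv j) - inverse (pairing r s i j) \<cdot> var (F i) |i j. True}"

definition rels_G3 :: "'k::field \<Rightarrow> 'k \<Rightarrow> (gen, 'k) free_alg set" where
  "rels_G3 r s =
     {var (W' j) * var (E i) * var (W'inv j) - inverse (pairing r s j i) \<cdot> var (E i) |i j. True}
   \<union> {var (W' j) * var (F i) * var (W'inv j) - pairing r s j i \<cdot> var (F i) |i j. True}"

definition rels_G4 :: "'k::field \<Rightarrow> 'k \<Rightarrow> (gen, 'k) free_alg set" where
  "rels_G4 r s =
     {var (E i) * var (F j) - var (F j) * var (E i)
        - (if i = j then inverse (param r i - param s i) \<cdot> (var (W i) - var (W' i)) else 0)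
      |i j. True}"

definition rels_G5 :: "'k::field \<Rightarrow> 'k \<Rightarrow> (gen, 'k) free_alg set" where
  "rels_G5 r s = (let e1 = var (E I1); e2 = var (E I2) in
     {e2^2 * e1 - (inverse (r^3) + inverse (s^3)) \<cdot> (e2 * e1 * e2)
        + inverse ((r * s)^3) \<cdot> (e1 * e2^2),
      e1^4 * e2 - ((r + s) * (r^2 + s^2)) \<cdot> (e1^3 * e2 * e1)
        + (r * s * (r^2 + s^2) * (r^2 + r * s + s^2)) \<cdot> (e1^2 * e2 * e1^2)
        - ((r * s)^3 * (r + s) * (r^2 + s^2)) \<cdot> (e1 * e2 * e1^3)
        + (r * s)^6 \<cdot> (e2 * e1^4)})"

definition rels_G6 :: "'k::field \<Rightarrow> 'k \<Rightarrow> (gen, 'k) free_alg set" where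
  "rels_G6 r s = (let f1 = var (F I1); f2 = var (F I2) in
     {f1 * f2^2 - (inverse (r^3) + inverse (s^3)) \<cdot> (f2 * f1 * f2)
        + inverse ((r * s)^3) \<cdot> (f2^2 * f1),
      f2 * f1^4 - ((r + s) * (r^2 + s^2)) \<cdot> (f1 * f2 * f1^3)
        + (r * s * (r^2 + s^2) * (r^2 + r * s + s^2)) \<cdot> (f1^2 * f2 * f1^2)
        - ((r * s)^3 * (r + s) * (r^2 + s^2)) \<cdot> (f1^3 * f2 * f1)
        + (r * s)^6 \<cdot> (f1^4 * f2)})"

text \<open>\<^const>\<open>genideal\<close> is the two-sided ideal. It contains the products of its elements with scalars
  (as \<open>c \<cdot> p\<close> is a product in the free algebra), so the quotient ring below is the
  \<open>'k\<close>-algebra with the given presentation.\<close>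

definition UG2_ideal :: "'k::field \<Rightarrow> 'k \<Rightarrow> (gen, 'k) free_alg set" where
  "UG2_ideal r s = Idl\<^bsub>free_ring\<^esub>
     (rels_G1 \<union> rels_G2 r s \<union> rels_G3 r s \<union> rels_G4 r s \<union> rels_G5 r s \<union> rels_G6 r s)"

definition UG2 :: "'k::field \<Rightarrow> 'k \<Rightarrow> (gen, 'k) free_alg set ring" where
  "UG2 r s = free_ring Quot UG2_ideal r s"

definition UG2_class :: "'k::field \<Rightarrow> 'k \<Rightarrow> (gen, 'k) free_alg \<Rightarrow> (gen, 'k) free_alg set" where
  "UG2_class r s p = UG2_ideal r s +>\<^bsub>free_ring\<^esub> p"

lemma ideal_UG2_ideal: "ideal (UG2_ideal r s) free_ring"
  unfolding UG2_ideal_def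
  by (rule ring.genideal_ideal[OF ring_free_ring]) (simp add: ring_of_type_algebra_def)

lemma ring_UG2: "ring (UG2 r s)"
  unfolding UG2_def by (rule ideal.quotient_is_ring[OF ideal_UG2_ideal])

lemma UG2_class_hom: "UG2_class r s \<in> ring_hom free_ring (UG2 r s)"
  using ideal.rcos_ring_hom[OF ideal_UG2_ideal] unfolding UG2_def UG2_class_def .

section \<open>Quantum root vectors\<close>

datatype pos_root = R1 | R1112 | R112 | R11212 | R12 | R2

text \<open>Representatives in the free algebra; the root vectors are their classes in \<^const>\<open>UG2\<close>.\<close>

definition E12_rep :: "'k::field \<Rightarrow> 'k \<Rightarrow> (gen, 'k) free_alg" where
  "E12_rep r s = var (E I1) * var (E I2) - s^3 \<cdot> (var (E I2) * var (E I1))"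

definition E112_rep :: "'k::field \<Rightarrow> 'k \<Rightarrow> (gen, 'k) free_alg" where
  "E112_rep r s = var (E I1) * E12_rep r s - (r * s^2) \<cdot> (E12_rep r s * var (E I1))"

definition E1112_rep :: "'k::field \<Rightarrow> 'k \<Rightarrow> (gen, 'k) free_alg" where
  "E1112_rep r s = var (E I1) * E112_rep r s - (r^2 * s) \<cdot> (E112_rep r s * var (E I1))"

definition E11212_rep :: "'k::field \<Rightarrow> 'k \<Rightarrow> (gen, 'k) free_alg" where
  "E11212_rep r s = E112_rep r s * E12_rep r s - (r^2 * s) \<cdot> (E12_rep r s * E112_rep r s)"

definition F12_rep :: "'k::field \<Rightarrow> 'k \<Rightarrow> (gen, 'k) free_alg" where
  "F12_rep r s = var (F I2) * var (F I1) - r^3 \<cdot> (var (F I1) * var (F I2))"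

definition F112_rep :: "'k::field \<Rightarrow> 'k \<Rightarrow> (gen, 'k) free_alg" where
  "F112_rep r s = F12_rep r s * var (F I1) - (r^2 * s) \<cdot> (var (F I1) * F12_rep r s)"

definition F1112_rep :: "'k::field \<Rightarrow> 'k \<Rightarrow> (gen, 'k) free_alg" where
  "F1112_rep r s = F112_rep r s * var (F I1) - (r * s^2) \<cdot> (var (F I1) * F112_rep r s)"

definition F11212_rep :: "'k::field \<Rightarrow> 'k \<Rightarrow> (gen, 'k) free_alg" where
  "F11212_rep r s = F12_rep r s * F112_rep r s - (r * s^2) \<cdot> (F112_rep r s * F12_rep r s)"

fun E_rep :: "'k::field \<Rightarrow> 'k \<Rightarrow> pos_root \<Rightarrow> (gen, 'k) free_alg" where
  "E_rep r s R1 = var (E I1)"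
| "E_rep r s R1112 = E1112_rep r s"
| "E_rep r s R112 = E112_rep r s"
| "E_rep r s R11212 = E11212_rep r s"
| "E_rep r s R12 = E12_rep r s"
| "E_rep r s R2 = var (E I2)"

fun F_rep :: "'k::field \<Rightarrow> 'k \<Rightarrow> pos_root \<Rightarrow> (gen, 'k) free_alg" where
  "F_rep r s R1 = var (F I1)"
| "F_rep r s R1112 = F1112_rep r s"
| "F_rep r s R112 = F112_rep r s"
| "F_rep r s R11212 = F11212_rep r s"
| "F_rep r s R12 = F12_rep r s"
| "F_rep r s R2 = var (F I2)"

definition E_root :: "'k::field \<Rightarrow> 'k \<Rightarrow> pos_root \<Rightarrow> (gen, 'k) free_alg set" where
  "E_root r s \<alpha> = UG2_class r s (E_rep r s \<alpha>)"

definition F_root :: "'k::field \<Rightarrow> 'k \<Rightarrow> pos_root \<Rightarrow> (gen, 'k) free_alg set" where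
  "F_root r s \<alpha> = UG2_class r s (F_rep r s \<alpha>)"

definition omega :: "'k::field \<Rightarrow> 'k \<Rightarrow> idx \<Rightarrow> (gen, 'k) free_alg set" where
  "omega r s k = UG2_class r s (var (W k))"

definition omega' :: "'k::field \<Rightarrow> 'k \<Rightarrow> idx \<Rightarrow> (gen, 'k) free_alg set" where
  "omega' r s k = UG2_class r s (var (W' k))"

end

theory Submission
  imports Defs
begin

text \<open>Fix a root vector \<open>x = E\<^sub>\<alpha>\<close> and a generator \<open>y\<close>. Multiplications by \<open>x\<close> from the left
  and from the right are commuting operators \<open>L\<close> and \<open>R\<close>. The commutation relations of the root
  vectors, which follow from the Serre relations, show that \<open>y\<close> is annihilated by a product of
  factors \<open>L - c R\<close> whose \<open>c\<close> are monomials in \<open>r\<close> and \<open>s\<close> forming a short geometric progression with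
  ratio a power of \<open>r / s\<close>. These \<open>c\<close> are distinct \<open>l\<close>-th roots of unity by the hypotheses on \<open>r\<close> and
  \<open>s\<close>, so the product divides \<open>L ^ l - R ^ l\<close>, and \<open>x ^ l\<close> commutes with \<open>y\<close>. The vectors \<open>F\<^sub>\<alpha>\<close>
  are the \<open>E\<^sub>\<alpha>\<close> of the opposite algebra with \<open>r\<close> and \<open>s\<close> exchanged.\<close>

section \<open>Annihilation by linear factors in multiplication operators\<close>

text \<open>The hypotheses on \<open>r\<close> and \<open>s\<close> act twice. Apart from separating
  the scalars, they make the commutation relations derivable: multiplication by \<open>a\<close>
  only yields multiples of the wanted relations, and the factors \<open>r + s\<close>,
  \<open>r^2 + s^2\<close> (both nonzero because \<open>r^4\<close> and \<open>s^4\<close> differ)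
  and \<open>r^2 - r*s + s^2\<close> have to be cancelled. The relations carry remainders, some of
  them nonlinear, such as \<open>c * c\<close> or \<open>g * (g * g)\<close>. Such a remainder is
  again built from root vectors and torus elements, and the scalars of its own relation with
  \<open>x\<close> continue the list already begun; at most four factors suffice for a short root
  and three for a long one. Torus generators only rescale root vectors, by \<open>l\<close>-th roots
  of unity, and are treated separately.\<close>

locale kalg = vector_space scale
  for scale :: "'k::field \<Rightarrow> 'a::ring_1 \<Rightarrow> 'a" (infixr "\<bullet>" 75) +
  assumes scale_mult_left: "(c \<bullet> x) * y = c \<bullet> (x * y)"
    and scale_mult_right: "x * (c \<bullet> y) = c \<bullet> (x * y)"
begin

lemmas kalg_simps = algebra_simps scale_mult_left scale_mult_right

fun chain :: "'a \<Rightarrow> 'k list \<Rightarrow> 'a \<Rightarrow> bool" where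
  "chain x [] y \<longleftrightarrow> y = 0"
| "chain x (c # cs) y \<longleftrightarrow> chain x cs (x * y - c \<bullet> (y * x))"

text \<open>\<open>p\<close>, homogenized to degree \<open>n\<close>, at left and right multiplication by \<open>x\<close>.\<close>

definition bieval :: "'a \<Rightarrow> nat \<Rightarrow> 'k poly \<Rightarrow> 'a \<Rightarrow> 'a" where
  "bieval x n p y = (\<Sum>i\<le>n. coeff p i \<bullet> (x ^ i * y * x ^ (n - i)))"

text \<open>Homogenization is multiplicative, and left and right multiplication by \<open>x\<close>
  commute; so the factor \<open>X - c\<close> can be split off and applied to \<open>y\<close>
  first.\<close>

lemma bieval_linear_factor:
  assumes "degree q \<le> n"
  shows "bieval x (Suc n) ([:- c, 1:] * q) y = bieval x n q (x * y - c \<bullet> (y * x))"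
proof -
  let ?m = "\<lambda>i. x ^ i * y * x ^ (Suc n - i)"
  \<comment> \<open>The top term of the second sum has no factor \<open>x\<close> to the right of
    \<open>y\<close> that could be absorbed; the degree bound removes it.\<close>
  have "coeff q (Suc n) = 0" using assms by (simp add: coeff_eq_0)
  have "bieval x (Suc n) ([:- c, 1:] * q) y = 
     (\<Sum>i\<le>Suc n. (coeff (pCons 0 q) i - c * coeff q i) \<bullet> ?m i)"
    unfolding bieval_def by (simp add: algebra_simps)
  also have "\<dots> = (\<Sum>i\<le>Suc n. coeff (pCons 0 q) i \<bullet> ?m i) - (\<Sum>i\<le>Suc n. (c * coeff q i) \<bullet> ?m i)"
    by (simp only: scale_left_diff_distrib sum_subtractf)
  also have "(\<Sum>i\<le>Suc n. coeff (pCons 0 q) i \<bullet> ?m i) = (\<Sum>i\<le>n. coeff q i \<bullet> (x ^ i * (x * y) * x ^ (n - i)))"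
  proof -
    have "x ^ Suc i * y = x ^ i * (x * y)" for i by (simp only: power_Suc2 mult.assoc)
    then show ?thesis by (subst sum.atMost_Suc_shift) (simp del: power_Suc)
  qed
  also have "(\<Sum>i\<le>Suc n. (c * coeff q i) \<bullet> ?m i) = (\<Sum>i\<le>n. coeff q i \<bullet> (x ^ i * (c \<bullet> (y * x)) * x ^ (n - i)))"
    using \<open>coeff q (Suc n) = 0\<close>
    by (auto intro!: sum.cong simp: kalg_simps Suc_diff_le)
  finally show ?thesis
    by (simp add: bieval_def sum_subtractf right_diff_distrib left_diff_distrib scale_right_diff_distrib)
qed

text \<open>Each root \<open>c\<close> of \<open>p\<close> splits off one linear factor, which
  performs one step of the chain; at the end of the chain the argument is \<open>0\<close>.\<close>

lemma bieval_chain: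
  assumes "chain x cs y" "distinct cs" "\<forall>c\<in>set cs. poly p c = 0" "degree p \<le> n"
  shows "bieval x n p y = 0"
  using assms
proof (induction cs arbitrary: n p y)
  case Nil
  then show ?case by (simp add: bieval_def)
next
  case (Cons c cs)
  then obtain q where p: "p = [:- c, 1:] * q"
    by (auto simp: poly_eq_0_iff_dvd)
  show ?case
  proof (cases "q = 0")
    case True
    then show ?thesis by (simp add: p bieval_def)
  next
    case False
    then have "degree p = Suc (degree q)"
      by (simp add: p degree_mult_eq del: mult_pCons_left)
    then have "Suc (degree q) \<le> n" using Cons.prems(4) by simp
    then obtain m where m: "n = Suc m" "degree q \<le> m" by (cases n) simp_all
    \<comment> \<open>Distinctness enters here: a root \<open>c'\<close> other than \<open>c\<close>
      is not a root of \<open>X - c\<close>, hence it is one of \<open>q\<close>.\<close>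
    have "\<forall>c'\<in>set cs. poly q c' = 0" using Cons.prems(2,3) by (auto simp: p)
    then have "bieval x m q (x * y - c \<bullet> (y * x)) = 0"
      using Cons.prems(1,2) m(2) by (intro Cons.IH) simp_all
    then show ?thesis unfolding m(1) p bieval_linear_factor[OF m(2)] .
  qed
qed

text \<open>The polynomial is \<open>X^l - 1\<close>, whose homogenization sends \<open>y\<close> to
  \<open>x ^ l * y - y * x ^ l\<close>.\<close>

lemma power_commute_chain:
  assumes "chain x cs y" "distinct cs" "\<forall>c\<in>set cs. c ^ l = 1" "l > 0"
  shows "x ^ l * y = y * x ^ l"
proof -
  let ?p = "monom 1 l - 1 :: 'k poly"
  have "bieval x l ?p y = 0"
  proof (rule bieval_chain[OF assms(1,2)])
    show "\<forall>c\<in>set cs. poly ?p c = 0" using assms(3) by (simp add: poly_monom)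
    show "degree ?p \<le> l" by (rule degree_diff_le) (simp_all add: degree_monom_le)
  qed
  moreover have "bieval x l ?p y = x ^ l * y - y * x ^ l"
  proof -
    have "bieval x l ?p y = (\<Sum>i\<le>l. (if i = l then x ^ l * y else 0) - (if i = 0 then y * x ^ l else 0))"
      unfolding bieval_def
    proof (rule sum.cong[OF refl])
      fix i
      have "coeff ?p i = (if i = l then 1 else 0) - (if i = 0 then 1 else 0)"
        by simp
      then show "coeff ?p i \<bullet> (x ^ i * y * x ^ (l - i)) =
          (if i = l then x ^ l * y else 0) - (if i = 0 then y * x ^ l else 0)"
        using \<open>l > 0\<close> by (simp only: scale_left_diff_distrib) simp
    qed
    then show ?thesis by (simp add: sum_subtractf)
  qed
  ultimately show ?thesis by simp
qed

text \<open>Two equal terms of the progression would give \<open>t ^ i = 1\<close> for the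
  difference \<open>i\<close> of their exponents, so only \<open>0 < i < n\<close> has to be
  excluded.\<close>

lemma power_commute_geometric_chain:
  assumes "chain x (map (\<lambda>i. c * t ^ i) [0..<n]) y"
    and "c ^ l = 1" "t ^ l = 1" "l > 0" "\<forall>i\<in>{0<..<n}. t ^ i \<noteq> 1"
  shows "x ^ l * y = y * x ^ l"
proof (rule power_commute_chain[OF assms(1) _ _ assms(4)])
  have "c \<noteq> 0" "t \<noteq> 0" using assms(2-4) by (auto simp: power_0_left)
  have neq: "t ^ i \<noteq> t ^ j" if "i < j" "j < n" for i j
  proof
    assume "t ^ i = t ^ j"
    moreover have "t ^ j = t ^ i * t ^ (j - i)" using that by (simp flip: power_add)
    ultimately have "t ^ (j - i) = 1" using \<open>t \<noteq> 0\<close> by simp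
    moreover have "j - i \<in> {0<..<n}" using that by auto
    ultimately show False using assms(5) by blast
  qed
  have "inj_on ((^) t) {0..<n}"
    by (rule linorder_inj_onI) (auto dest: neq)
  then show "distinct (map (\<lambda>i. c * t ^ i) [0..<n])"
    using \<open>c \<noteq> 0\<close> by (auto simp: distinct_map inj_on_def)
  have "(t ^ i) ^ l = 1" for i using assms(3) by (metis mult.commute power_mult power_one)
  then show "\<forall>z\<in>set (map (\<lambda>i. c * t ^ i) [0..<n]). z ^ l = 1"
    using assms(2) by (auto simp: power_mult_distrib)
qed

section \<open>Calculus of chains\<close>

lemma chain_0 [simp]: "chain x cs 0"
  by (induction cs) simp_all

lemma chain_add: "chain x cs y \<Longrightarrow> chain x cs z \<Longrightarrow> chain x cs (y + z)"
proof (induction cs arbitrary: y z)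
  case (Cons c cs)
  then have "chain x cs ((x * y - c \<bullet> (y * x)) + (x * z - c \<bullet> (z * x)))" by simp
  then show ?case by (simp add: algebra_simps)
qed simp

lemma chain_scale: "chain x cs y \<Longrightarrow> chain x cs (a \<bullet> y)"
proof (induction cs arbitrary: y)
  case (Cons c cs)
  then have "chain x cs (a \<bullet> (x * y - c \<bullet> (y * x)))" by simp
  then show ?case by (simp add: kalg_simps mult.commute)
qed simp

lemma chain_diff: "chain x cs y \<Longrightarrow> chain x cs z \<Longrightarrow> chain x cs (y - z)"
  using chain_add[of x cs y "(- 1) \<bullet> z"] chain_scale[of x cs z "- 1"] by simp

text \<open>The operators for different scalars commute, so a further factor may also be put in
  front. This brings summands with different scalars under one list.\<close>

lemma chain_Cons: "chain x cs y \<Longrightarrow> chain x (c # cs) y"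
proof (induction cs arbitrary: y)
  case (Cons a cs)
  let ?D = "\<lambda>c y. x * y - c \<bullet> (y * x)"
  have "?D c (?D a y) = ?D a (?D c y)" by (simp add: kalg_simps)
  moreover have "chain x cs (?D c (?D a y))" using Cons by simp
  ultimately show ?case by (simp only: chain.simps)
qed simp

lemma chain_step: "x * y = c \<bullet> (y * x) + z \<Longrightarrow> chain x cs z \<Longrightarrow> chain x (c # cs) y"
  by simp

text \<open>Relations are recorded with the vector earlier in the convex order on the left. If
  \<open>x\<close> is the later one, solving for \<open>x * y\<close> inverts the scalar.\<close>

lemma chain_step': "y * x = c \<bullet> (x * y) + z \<Longrightarrow> chain x cs z \<Longrightarrow> c \<noteq> 0 \<Longrightarrow> chain x (inverse c # cs) y"
  using chain_scale[of x cs z "- inverse c"] by (simp add: kalg_simps)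

text \<open>Passing \<open>w\<close> across \<open>x\<close> costs a scalar, which merely rescales
  the whole list. This and its left version treat remainders with a torus factor.\<close>

lemma chain_mult_right:
  assumes "w * x = a \<bullet> (x * w)" "a \<noteq> 0" "chain x cs y"
  shows "chain x (map (\<lambda>c. c / a) cs) (y * w)"
  using assms(3)
proof (induction cs arbitrary: y)
  case (Cons c cs)
  have "x * (y * w) - (c / a) \<bullet> (y * w * x) = (x * y - c \<bullet> (y * x)) * w"
    using assms(1,2) by (simp add: kalg_simps)
  with Cons show ?case by simp
qed simp

lemma chain_mult_left:
  assumes "x * w = a \<bullet> (w * x)" "chain x cs y"
  shows "chain x (map (\<lambda>c. a * c) cs) (w * y)"
  using assms(2)
proof (induction cs arbitrary: y)
  case (Cons c cs)
  have w: "x * (w * z) = a \<bullet> (w * (x * z))" for z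
    using assms(1) by (metis mult.assoc scale_mult_left)
  have "x * (w * y) - (a * c) \<bullet> (w * y * x) = a \<bullet> (w * (x * y - c \<bullet> (y * x)))"
    by (simp add: kalg_simps w)
  moreover have "chain x (map ((*) a) cs) (w * (x * y - c \<bullet> (y * x)))" using Cons by simp
  ultimately show ?case by (simp only: list.map chain.simps chain_scale)
qed simp

end

section \<open>Commutation relations of the root vectors\<close>

text \<open>Simplification nests products to the right, where a two-letter relation no longer
  matches inside a longer word; this form does.\<close>

lemma assoc_rule: "x * y = z \<Longrightarrow> x * (y * w) = z * w" for x y z w :: "'a::semigroup_mult"
  by (simp add: mult.assoc[symmetric])

text \<open>\<open>a\<close>, \<open>b\<close>, \<open>c\<close>, \<open>d\<close>, \<open>g\<close>, \<open>e\<close> are \<open>E\<^sub>1\<close>, \<open>E\<^sub>1\<^sub>1\<^sub>1\<^sub>2\<close>, \<open>E\<^sub>1\<^sub>1\<^sub>2\<close>, \<open>E\<^sub>1\<^sub>1\<^sub>2\<^sub>1\<^sub>2\<close>, \<open>E\<^sub>1\<^sub>2\<close>, \<open>E\<^sub>2\<close>, in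
  convex order. The assumptions \<open>ab\<close> and \<open>ge\<close> are the Serre relations. Multiplying a relation by \<open>a\<close>
  from the left and expanding both sides yields the next one for \<open>bg\<close>, \<open>bc\<close>, \<open>dg\<close> and \<open>cd\<close>.\<close>

locale G2_root_vectors = kalg scale for scale :: "'k::field \<Rightarrow> 'a::ring_1 \<Rightarrow> 'a" (infixr "\<bullet>" 75) +
  fixes r s k :: 'k and a b c d e g :: 'a
  assumes nz: "r \<noteq> 0" "s \<noteq> 0" "r + s \<noteq> 0" "r^2 + s^2 \<noteq> 0" "r^2 - r*s + s^2 \<noteq> 0"
    and k: "k * (r + s) = r * (r^3 - s^3)"
    and ag: "a * g = (r*s^2) \<bullet> (g * a) + c"
    and ac: "a * c = (r^2*s) \<bullet> (c * a) + b"
    and ab: "a * b = r^3 \<bullet> (b * a)"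
    and ae: "a * e = s^3 \<bullet> (e * a) + g"
    and cg: "c * g = (r^2*s) \<bullet> (g * c) + d"
    and ge: "g * e = r^3 \<bullet> (e * g)"
begin

text \<open>Identities are checked by expanding them into sums of monomials and cancelling, which merged
  numeral coefficients would block.\<close>

declare [[simproc del: int_combine_numerals field_combine_numerals]]

text \<open>The equation for \<open>k\<close>, oriented to eliminate \<open>k * r\<close>, lets
  identities in \<open>r\<close>, \<open>s\<close>, \<open>k\<close> be checked without division.
  The second form matches inside longer products.\<close>

lemma kr: "k * r = r*r*r*r - r*s*s*s - k*s" "k * (r*z) = r*r*r*r*z - r*s*s*s*z - k*s*z" 
proof -
  show "k * r = r*r*r*r - r*s*s*s - k*s" 
    using k by (simp add: algebra_simps power3_eq_cube)
  then show "k * (r*z) = r*r*r*r*z - r*s*s*s*z - k*s*z" 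
    by (metis left_diff_distrib mult.assoc)
qed

lemmas base = ag ac ab ae cg ge
lemmas ag' = ag[THEN assoc_rule] and ac' = ac[THEN assoc_rule] and ab' = ab[THEN assoc_rule]
  and ae' = ae[THEN assoc_rule] and cg' = cg[THEN assoc_rule] and ge' = ge[THEN assoc_rule]
lemmas base' = ag' ac' ab' ae' cg' ge'
lemmas exp_simps = kalg_simps power2_eq_square power3_eq_cube eval_nat_numeral

text \<open>\<open>c\<close> is a bracket of \<open>a\<close> and \<open>g\<close>, and
  \<open>e\<close> can be moved past both. In the same way \<open>be\<close> and \<open>de\<close>
  come from the brackets for \<open>b\<close> and \<open>d\<close>, and later \<open>bd\<close> from
  that for \<open>b\<close>.\<close>

lemma ce: "c * e = (r^3*s^3) \<bullet> (e * c) + (r^3 - r*s^2) \<bullet> (g * g)"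
proof -
  have "c * e = a * (g * e) - (r*s^2) \<bullet> (g * (a * e))" by (simp add: ag' kalg_simps)
  also have "\<dots> = a * (r^3 \<bullet> (e * g)) - (r*s^2) \<bullet> (g * (s^3 \<bullet> (e * a) + g))" by (simp only: ge ae)
  also have "\<dots> = (r^3*s^3) \<bullet> (e * c) + (r^3 - r*s^2) \<bullet> (g * g)"
    by (simp add: base base' exp_simps)
  finally show ?thesis .
qed
lemmas ce' = ce[THEN assoc_rule]

lemma be: "b * e = (r^3*s^6) \<bullet> (e * b) + (r^2*s*(r^3-s^3)) \<bullet> (g * c) + (r^3 - r*s^2-r^2*s) \<bullet> d"
proof -
  have "b * e = a * (c * e) - (r^2*s) \<bullet> (c * (a * e))" by (simp add: ac' kalg_simps)
  also have "\<dots> = a * ((r^3*s^3) \<bullet> (e * c) + (r^3 - r*s^2) \<bullet> (g * g)) - (r^2*s) \<bullet> (c * (s^3 \<bullet> (e * a) + g))"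
    by (simp only: ce ae)
  also have "\<dots> = (r^3*s^6) \<bullet> (e * b) + (r^2*s*(r^3-s^3)) \<bullet> (g * c) + (r^3 - r*s^2-r^2*s) \<bullet> d"
    by (simp add: base base' ce ce' exp_simps)
  finally show ?thesis .
qed
lemmas be' = be[THEN assoc_rule]

lemma de: "d * e = (r^6*s^3) \<bullet> (e * d) + ((r^3 - r^2*s)*(r^3 - r*s^2)) \<bullet> (g * (g * g))"
proof -
  have "d * e = c * (g * e) - (r^2*s) \<bullet> (g * (c * e))" by (simp add: cg' kalg_simps)
  also have "\<dots> = c * (r^3 \<bullet> (e * g)) - (r^2*s) \<bullet> (g * ((r^3*s^3) \<bullet> (e * c) + (r^3 - r*s^2) \<bullet> (g * g)))"
    by (simp only: ge ce)
  also have "\<dots> = (r^6*s^3) \<bullet> (e * d) + ((r^3 - r^2*s)*(r^3 - r*s^2)) \<bullet> (g * (g * g))"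
    by (simp add: base base' ce ce' exp_simps)
  finally show ?thesis .
qed
lemmas de' = de[THEN assoc_rule]

text \<open>Moving \<open>a\<close> through the bracket that gives \<open>d\<close> leaves exactly
  the still unknown remainder of \<open>b * g\<close>, so \<open>ad\<close> has to wait for
  \<open>bg\<close>.\<close>

lemma ad_bg: "a * d = (r^3*s^3) \<bullet> (d * a) + (b * g - (r^3*s^3) \<bullet> (g * b))"
proof -
  have d: "d = c * g - (r^2*s) \<bullet> (g * c)" using cg by simp
  show ?thesis
    unfolding d by (simp add: ag ac ag' ac' exp_simps)
qed

lemma bg: "b * g = (r^3*s^3) \<bullet> (g * b) + k \<bullet> (c * c)"
proof -
  let ?R = "(r^3*s^6) \<bullet> (e * b) + (r^2*s*(r^3-s^3)) \<bullet> (g * c) + (r^3 - r*s^2-r^2*s) \<bullet> d"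
  have "a * b * e = a * ?R" using be by (simp add: mult.assoc)
  moreover have "a * b * e = (r^3*s^3) \<bullet> (?R * a) + r^3 \<bullet> (b * g)"
    by (simp only: ab scale_mult_left mult.assoc ae be' distrib_left scale_mult_right scale_scale scale_right_distrib)
  \<comment> \<open>Cancelling \<open>r + s\<close> from the coefficient of \<open>c * c\<close> is
    the origin of \<open>k\<close>, the quotient of \<open>r * (r^3 - s^3)\<close> by
    \<open>r + s\<close>.\<close>
  moreover have "(r*s*(r+s)) \<bullet> (b * g - (r^3*s^3) \<bullet> (g * b) - k \<bullet> (c * c)) =
     ((r^3*s^3) \<bullet> (?R * a) + r^3 \<bullet> (b * g)) - a * ?R"
    by (simp add: base base' ad_bg exp_simps kr)
  ultimately have "(r*s*(r+s)) \<bullet> (b * g - (r^3*s^3) \<bullet> (g * b) - k \<bullet> (c * c)) = 0" by simp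
  then have "b * g - (r^3*s^3) \<bullet> (g * b) - k \<bullet> (c * c) = 0" using nz by simp
  then show ?thesis by (simp add: algebra_simps)
qed
lemmas bg' = bg[THEN assoc_rule]

lemma ad: "a * d = (r^3*s^3) \<bullet> (d * a) + k \<bullet> (c * c)"
  using ad_bg bg by simp
lemmas ad' = ad[THEN assoc_rule]

text \<open>\<open>(r + s) * (r^3 - k) = r * s * (r^2 + s^2)\<close>. The factor
  \<open>r^3 - k\<close> is cancelled in \<open>bc\<close> and, up to sign, in
  \<open>cd\<close>.\<close>

lemma k_neq: "k \<noteq> r^3"
proof
  assume "k = r^3"
  then have "r * s * (r^2 + s^2) = 0" using k by (simp add: algebra_simps power3_eq_cube power2_eq_square)
  with nz show False by simp
qed

lemma bc: "b * c = r^3 \<bullet> (c * b)"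
proof -
  let ?R = "(r^3*s^3) \<bullet> (g * b) + k \<bullet> (c * c)"
  have "a * b * g = a * ?R" using bg by (simp add: mult.assoc)
  moreover have "a * b * g = r^3 \<bullet> ((r*s^2) \<bullet> (?R * a) + b * c)"
    by (simp only: ab scale_mult_left mult.assoc ag bg' distrib_left scale_mult_right scale_scale scale_right_distrib)
  moreover have "(r + s) \<bullet> (r^3 - k) \<bullet> (b * c - r^3 \<bullet> (c * b)) =
     (r + s) \<bullet> (r^3 \<bullet> ((r*s^2) \<bullet> (?R * a) + b * c) - a * ?R)"
    by (simp add: base base' exp_simps kr)
  ultimately have "(r + s) \<bullet> (r^3 - k) \<bullet> (b * c - r^3 \<bullet> (c * b)) = 0" by simp
  with nz k_neq show ?thesis by simp
qed
lemmas bc' = bc[THEN assoc_rule]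

lemma dg: "d * g = r^3 \<bullet> (g * d)"
proof -
  let ?R = "(r^6*s^3) \<bullet> (e * d) + ((r^3 - r^2*s)*(r^3 - r*s^2)) \<bullet> (g * (g * g))"
  have "a * d * e = a * ?R" using de by (simp add: mult.assoc)
  moreover have "a * d * e = (r^3*s^3) \<bullet> (s^3 \<bullet> (?R * a) + d * g) + k \<bullet> (c * (c * e))"
    by (simp only: ad scale_mult_left mult.assoc ae de' distrib_left scale_mult_right scale_scale 
         scale_right_distrib distrib_right)
  \<comment> \<open>The two evaluations of \<open>a * d * e\<close> differ by a multiple with factor
    \<open>r^2 - r*s + s^2\<close>, which is nonzero by hypothesis.\<close>
  moreover have "(r^2*s^2*(r^2 - r*s + s^2)) \<bullet> (d * g - r^3 \<bullet> (g * d)) =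
     (r^3*s^3) \<bullet> (s^3 \<bullet> (?R * a) + d * g) + k \<bullet> (c * (c * e)) - a * ?R"
    by (simp add: base base' ce ce' ad exp_simps kr)
  ultimately have "(r^2*s^2*(r^2 - r*s + s^2)) \<bullet> (d * g - r^3 \<bullet> (g * d)) = 0" by simp
  with nz show ?thesis by simp
qed
lemmas dg' = dg[THEN assoc_rule]

lemma cd: "c * d = r^3 \<bullet> (d * c)"
proof -
  let ?R = "r^3 \<bullet> (g * d)"
  have "a * d * g = a * ?R" using dg by (simp add: mult.assoc)
  moreover have "a * d * g = (r^3*s^3) \<bullet> ((r*s^2) \<bullet> (?R * a) + d * c) + k \<bullet> (c * (c * g))"
    by (simp only: ad scale_mult_left mult.assoc ag dg' distrib_left scale_mult_right scale_scale 
         scale_right_distrib distrib_right)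
  moreover have "(r + s) \<bullet> (k - r^3) \<bullet> (c * d - r^3 \<bullet> (d * c)) =
     (r + s) \<bullet> ((r^3*s^3) \<bullet> ((r*s^2) \<bullet> (?R * a) + d * c) + k \<bullet> (c * (c * g)) - a * ?R)"
    by (simp add: base base' ad ad' exp_simps kr)
  ultimately have "(r + s) \<bullet> (k - r^3) \<bullet> (c * d - r^3 \<bullet> (d * c)) = 0" by simp
  with nz k_neq show ?thesis by simp
qed
lemmas cd' = cd[THEN assoc_rule]

lemma bd: "b * d = (r^6*s^3) \<bullet> (d * b) + (k*(r^3-r^2*s)) \<bullet> (c * (c * c))"
proof -
  have "b * d = a * (c * d) - (r^2*s) \<bullet> (c * (a * d))" by (simp add: ac' kalg_simps)
  also have "\<dots> = a * (r^3 \<bullet> (d * c)) - (r^2*s) \<bullet> (c * ((r^3*s^3) \<bullet> (d * a) + k \<bullet> (c * c)))"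
    by (simp only: cd ad)
  also have "\<dots> = (r^6*s^3) \<bullet> (d * b) + (k*(r^3-r^2*s)) \<bullet> (c * (c * c))"
    by (simp add: base base' ad ad' cd cd' exp_simps)
  finally show ?thesis .
qed

end

section \<open>Commutators with the opposite generators\<close>

text \<open>\<open>f\<close>, \<open>h\<close> are \<open>f\<^sub>1\<close>, \<open>f\<^sub>2\<close>; \<open>w\<close>, \<open>w'\<close> are \<open>\<omega>\<^sub>1\<close>, \<open>\<omega>\<^sub>1'\<close> divided by \<open>r - s\<close>; \<open>v\<close>, \<open>v'\<close> are
  \<open>\<omega>\<^sub>2\<close>, \<open>\<omega>\<^sub>2'\<close> divided by \<open>r\<^sup>3 - s\<^sup>3\<close>.\<close>

locale G2_root_vectors_extended = G2_root_vectors scale for scale :: "'k::field \<Rightarrow> 'a::ring_1 \<Rightarrow> 'a" (infixr "\<bullet>" 75) +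
  fixes f h w w' v v' :: 'a
  assumes af: "a * f = f * a + w - w'" and ef: "e * f = f * e"
    and ah: "a * h = h * a" and eh: "e * h = h * e + v - v'"
    and wa: "w * a = (r / s) \<bullet> (a * w)" and we: "w * e = s^3 \<bullet> (e * w)"
    and w'a: "w' * a = (s / r) \<bullet> (a * w')" and w'e: "w' * e = r^3 \<bullet> (e * w')"
    and av: "a * v = r^3 \<bullet> (v * a)" and ev: "e * v = (s^3 / r^3) \<bullet> (v * e)"
    and av': "a * v' = s^3 \<bullet> (v' * a)" and ev': "e * v' = (r^3 / s^3) \<bullet> (v' * e)"
begin

text \<open>Twists multiply along products, so both terms of a bracket have the same twist, whatever
  \<delta> is. A separate \<gamma> allows a simplified scalar to be supplied.\<close>

lemma qcomm_mult: "y * x = \<alpha> \<bullet> (x * y) \<Longrightarrow> y * z = \<beta> \<bullet> (z * y) \<Longrightarrow> \<gamma> = \<alpha> * \<beta> \<Longrightarrow> 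
  y * (x * z - \<delta> \<bullet> (z * x)) = \<gamma> \<bullet> ((x * z - \<delta> \<bullet> (z * x)) * y)"
  by (simp add: kalg_simps assoc_rule[of y])

lemma qcomm_mult': "x * y = \<alpha> \<bullet> (y * x) \<Longrightarrow> z * y = \<beta> \<bullet> (y * z) \<Longrightarrow> \<gamma> = \<alpha> * \<beta> \<Longrightarrow> 
  (x * z - \<delta> \<bullet> (z * x)) * y = \<gamma> \<bullet> (y * (x * z - \<delta> \<bullet> (z * x)))"
  by (simp add: kalg_simps assoc_rule[of x y] assoc_rule[of z y])

section \<open>Twists of the root vectors by the torus elements\<close>

lemma g_eq: "g = a * e - s^3 \<bullet> (e * a)" using ae by simp
lemma c_eq: "c = a * g - (r*s^2) \<bullet> (g * a)" using ag by simp
lemma b_eq: "b = a * c - (r^2*s) \<bullet> (c * a)" using ac by simp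
lemma d_eq: "d = c * g - (r^2*s) \<bullet> (g * c)" using cg by simp

lemma wg: "w * g = (r*s^2) \<bullet> (g * w)"
  unfolding g_eq by (rule qcomm_mult[OF wa we]) (simp add: field_simps eval_nat_numeral nz)
lemma wc: "w * c = (r^2*s) \<bullet> (c * w)"
  unfolding c_eq by (rule qcomm_mult[OF wa wg]) (simp add: field_simps eval_nat_numeral nz)
lemma w'g: "w' * g = (r^2*s) \<bullet> (g * w')"
  unfolding g_eq by (rule qcomm_mult[OF w'a w'e]) (simp add: field_simps eval_nat_numeral nz)
lemma w'c: "w' * c = (r*s^2) \<bullet> (c * w')"
  unfolding c_eq by (rule qcomm_mult[OF w'a w'g]) (simp add: field_simps eval_nat_numeral nz)
lemma w'b: "w' * b = s^3 \<bullet> (b * w')"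
  unfolding b_eq by (rule qcomm_mult[OF w'a w'c]) (simp add: field_simps eval_nat_numeral nz)
lemma w'd: "w' * d = (r^3*s^3) \<bullet> (d * w')"
  unfolding d_eq by (rule qcomm_mult[OF w'c w'g]) (simp add: field_simps eval_nat_numeral nz)

lemma gv: "g * v = s^3 \<bullet> (v * g)"
  unfolding g_eq by (rule qcomm_mult'[OF av ev]) (simp add: field_simps eval_nat_numeral nz)
lemma cv: "c * v = (r^3*s^3) \<bullet> (v * c)"
  unfolding c_eq by (rule qcomm_mult'[OF av gv]) (simp add: field_simps eval_nat_numeral nz)
lemma bv: "b * v = (r^6*s^3) \<bullet> (v * b)"
  unfolding b_eq by (rule qcomm_mult'[OF av cv]) (simp add: field_simps eval_nat_numeral nz)
lemma dv: "d * v = (r^3*s^6) \<bullet> (v * d)"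
  unfolding d_eq by (rule qcomm_mult'[OF cv gv]) (simp add: field_simps eval_nat_numeral nz)

text \<open>The bracket scalar \<open>s^3\<close> is also the twist of \<open>e\<close> by
  \<open>w\<close>, so \<open>w\<close> drops out, while \<open>w'\<close> leaves
  \<open>r^3 - s^3\<close>. By \<open>wg\<close> and \<open>wc\<close>, \<open>w\<close> drops out
  of \<open>cf\<close> and \<open>bf\<close> too.\<close>

lemma gf: "g * f = f * g - (r^3 - s^3) \<bullet> (e * w')"
  unfolding g_eq
  by (simp add: af af[THEN assoc_rule] ef ef[THEN assoc_rule] we w'e kalg_simps)

lemma cf: "c * f = f * c - (r^2*s - r*s^2 + r^3 - s^3) \<bullet> (g * w')"
proof -
  \<comment> \<open>With this scalar the term in \<open>e * (w' * a)\<close> cancels the term in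
    \<open>e * a * w'\<close> that comes from \<open>ae\<close>.\<close>
  have w'a2: "(r*s^2) \<bullet> (w' * a) = s^3 \<bullet> (a * w')"
    using nz by (simp add: w'a power2_eq_square power3_eq_cube)
  have "c * f = a * (g * f) - (r*s^2) \<bullet> (g * (a * f))" by (simp add: ag' kalg_simps)
  also have "\<dots> = a * (f * g - (r^3 - s^3) \<bullet> (e * w')) - (r*s^2) \<bullet> (g * (f * a + w - w'))"
    by (simp only: gf af)
  also have "\<dots> = a * f * g - (r^3 - s^3) \<bullet> (a * e * w') - (r*s^2) \<bullet> (g * f * a + g * w - g * w')"
    by (simp add: kalg_simps)
  also have "\<dots> = (f * a + w - w') * g - (r^3 - s^3) \<bullet> ((s^3 \<bullet> (e * a) + g) * w')
      - (r*s^2) \<bullet> (f * g * a + g * w - g * w') + (r^3 - s^3) \<bullet> (e * ((r*s^2) \<bullet> (w' * a)))"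
    by (simp only: af gf ae) (simp add: kalg_simps)
  also have "\<dots> = f * c - (r^2*s - r*s^2 + r^3 - s^3) \<bullet> (g * w')"
    unfolding w'a2 by (simp add: ag wg w'g kalg_simps)
  finally show ?thesis .
qed

lemma bf: "b * f = f * b - (r^3 - s^3) \<bullet> (c * w')"
proof -
  let ?k = "r^2*s - r*s^2 + r^3 - s^3"
  have w'a2: "(r^2*s) \<bullet> (w' * a) = (r*s^2) \<bullet> (a * w')"
    using nz by (simp add: w'a power2_eq_square power3_eq_cube)
  have "b * f = a * (c * f) - (r^2*s) \<bullet> (c * (a * f))" by (simp add: ac' kalg_simps)
  also have "\<dots> = a * (f * c - ?k \<bullet> (g * w')) - (r^2*s) \<bullet> (c * (f * a + w - w'))"
    by (simp only: cf af)
  also have "\<dots> = a * f * c - ?k \<bullet> (a * g * w') - (r^2*s) \<bullet> (c * f * a + c * w - c * w')"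
    by (simp add: kalg_simps)
  also have "\<dots> = (f * a + w - w') * c - ?k \<bullet> (((r*s^2) \<bullet> (g * a) + c) * w')
      - (r^2*s) \<bullet> (f * c * a + c * w - c * w') + ?k \<bullet> (g * ((r^2*s) \<bullet> (w' * a)))"
    by (simp only: af cf ag) (simp add: kalg_simps)
  also have "\<dots> = f * b - (r^3 - s^3) \<bullet> (c * w')"
    unfolding w'a2 by (simp add: ac wc w'c kalg_simps)
  finally show ?thesis .
qed

lemma df: "d * f = f * d - ((r^3 - s^3) * (r^3 - r*s^2)) \<bullet> (g * (g * w'))"
proof -
  let ?k = "r^2*s - r*s^2 + r^3 - s^3"
  have "d * f = c * (g * f) - (r^2*s) \<bullet> (g * (c * f))" by (simp add: cg' kalg_simps)
  also have "\<dots> = c * (f * g - (r^3 - s^3) \<bullet> (e * w')) - (r^2*s) \<bullet> (g * (f * c - ?k \<bullet> (g * w')))"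
    by (simp only: gf cf)
  also have "\<dots> = c * f * g - (r^3 - s^3) \<bullet> (c * e * w') - (r^2*s) \<bullet> (g * f * c - ?k \<bullet> (g * (g * w')))"
    by (simp add: kalg_simps)
  also have "\<dots> = f * d - ((r^3 - s^3) * (r^3 - r*s^2)) \<bullet> (g * (g * w'))"
    unfolding gf cf by (simp add: cg ce w'g w'c exp_simps)
  finally show ?thesis .
qed

text \<open>\<open>h\<close> commutes with \<open>a\<close>, so only \<open>e\<close> contributes.
  Here \<open>v'\<close> drops out, its twist with \<open>a\<close> being the bracket scalar
  \<open>s^3\<close>.\<close>

lemma gh: "g * h = h * g + (r^3 - s^3) \<bullet> (v * a)"
  unfolding g_eq
  by (simp add: ah ah[THEN assoc_rule] eh eh[THEN assoc_rule] av av' kalg_simps)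

lemma ch: "c * h = h * c + ((r^3 - s^3) * (r^3 - r*s^2)) \<bullet> (v * (a * a))"
proof -
  have "c * h = a * (g * h) - (r*s^2) \<bullet> (g * (a * h))" by (simp add: ag' kalg_simps)
  also have "\<dots> = h * c + ((r^3 - s^3) * (r^3 - r*s^2)) \<bullet> (v * (a * a))"
    by (simp add: gh ah gh[THEN assoc_rule] ah[THEN assoc_rule] ag av[THEN assoc_rule] kalg_simps)
  finally show ?thesis .
qed

lemma bh: "b * h = h * b + ((r^3 - s^3) * (r^3 - r*s^2) * (r^3 - r^2*s)) \<bullet> (v * (a * (a * a)))"
proof -
  have "b * h = a * (c * h) - (r^2*s) \<bullet> (c * (a * h))" by (simp add: ac' kalg_simps)
  also have "\<dots> = h * b + ((r^3 - s^3) * (r^3 - r*s^2) * (r^3 - r^2*s)) \<bullet> (v * (a * (a * a)))"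
    by (simp add: ch ah ch[THEN assoc_rule] ah[THEN assoc_rule] ac av[THEN assoc_rule] kalg_simps)
  finally show ?thesis .
qed

lemma dh: "d * h = h * d + v * ((r^3 - s^3) \<bullet> (
   (r^3*s^3 + (r^3 - r*s^2) * (r*s^2 + r^2*s) - r^4*s^2) \<bullet> (c * a) + (r^3 - r*s^2 - r^2*s) \<bullet> b))"
proof -
  have "d * h = c * (g * h) - (r^2*s) \<bullet> (g * (c * h))" by (simp add: cg' kalg_simps)
  also have "\<dots> = h * d + v * ((r^3 - s^3) \<bullet> (
   (r^3*s^3 + (r^3 - r*s^2) * (r*s^2 + r^2*s) - r^4*s^2) \<bullet> (c * a) + (r^3 - r*s^2 - r^2*s) \<bullet> b))"
    by (simp add: gh ch gh[THEN assoc_rule] ch[THEN assoc_rule] ag ag' ac ac' cg 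
     cv gv cv[THEN assoc_rule] gv[THEN assoc_rule] exp_simps)
  finally show ?thesis .
qed

end

section \<open>Powers of the root vectors\<close>

locale G2_root_vectors_at_roots_of_unity = G2_root_vectors_extended where scale = scale for scale :: "'k::field \<Rightarrow> 'a::ring_1 \<Rightarrow> 'a" (infixr "\<bullet>" 75) +
  fixes l :: nat
  assumes l: "l > 0" "r ^ l = 1" "s ^ l = 1"
    and generic: "r^3 \<noteq> s^3" "r^4 \<noteq> s^4"
begin

lemma rl [simp]: "(r ^ n) ^ l = 1" "r ^ l = 1"
  using l by (metis mult.commute power_mult power_one, simp)

lemma sl [simp]: "(s ^ n) ^ l = 1" "s ^ l = 1"
  using l by (metis mult.commute power_mult power_one, simp)

text \<open>A progression of four terms with ratio \<open>r / s\<close> needs exponents 1, 2, 3, and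
  one of three terms with ratio \<open>(r / s)^3\<close> needs 3 and 6. The last uses that
  \<open>r^6 - s^6\<close> is \<open>r^3 - s^3\<close> times
  \<open>(r + s) * (r^2 - r*s + s^2)\<close>.\<close>

lemma neq: "r \<noteq> s" "r^2 \<noteq> s^2" "r^6 \<noteq> s^6"
proof -
  show "r \<noteq> s" using generic by auto
  have "r ^ 4 = (r^2)^2" "s ^ 4 = (s^2)^2" by simp_all
  then show "r^2 \<noteq> s^2" using generic(2) by metis
  have "r^6 - s^6 = (r^3 - s^3) * ((r + s) * (r^2 - r*s + s^2))"
    by (simp add: algebra_simps eval_nat_numeral)
  then show "r^6 \<noteq> s^6" using generic nz by auto
qed

lemma chain_last: "x * y = p \<bullet> (y * x) \<Longrightarrow> chain x [p] y"
  by simp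

lemma chain_last': "y * x = p \<bullet> (x * y) \<Longrightarrow> p \<noteq> 0 \<Longrightarrow> chain x [inverse p] y"
  by simp

text \<open>Serves the short root vectors \<open>a\<close>, \<open>c\<close>, \<open>g\<close>, as
  \<open>commute_long\<close> serves the long ones \<open>b\<close>, \<open>d\<close>,
  \<open>e\<close>. Which of the two inverse ratios occurs depends on the side from which
  \<open>y\<close> is reached; a one-term chain fits either lemma.\<close>

lemma commute_short:
  assumes "chain x [p0, p1, p2, p3] y" "p1 = p0 * t" "p2 = p0 * t^2" "p3 = p0 * t^3"
    and "p0 ^ l = 1" "t = r / s \<or> t = s / r"
  shows "x ^ l * y = y * x ^ l"
proof (rule power_commute_geometric_chain)
  have "[0..<4] = [0, 1, 2, 3]" by (simp add: upt_rec)
  then have "map (\<lambda>i. p0 * t ^ i) [0..<4] = [p0, p1, p2, p3]"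
    using assms(2-4) by simp
  then show "chain x (map (\<lambda>i. p0 * t ^ i) [0..<4]) y" using assms(1) by simp
  show "t ^ l = 1" using assms(6) by (auto simp: power_divide)
  have "t \<noteq> 1" "t^2 \<noteq> 1" "t^3 \<noteq> 1" using assms(6) nz neq generic by (auto simp: power_divide)
  moreover have "{0<..<4} = {1, 2, 3::nat}" by auto
  ultimately show "\<forall>i\<in>{0<..<4}. t ^ i \<noteq> 1" by simp
qed (use assms l in auto)

lemma commute_long:
  assumes "chain x [p0, p1, p2] y" "p1 = p0 * t" "p2 = p0 * t^2"
    and "p0 ^ l = 1" "t = (r / s)^3 \<or> t = (s / r)^3"
  shows "x ^ l * y = y * x ^ l"
proof (rule power_commute_geometric_chain)
  have "[0..<3] = [0, 1, 2]" by (simp add: upt_rec)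
  then have "map (\<lambda>i. p0 * t ^ i) [0..<3] = [p0, p1, p2]"
    using assms(2-3) by simp
  then show "chain x (map (\<lambda>i. p0 * t ^ i) [0..<3]) y" using assms(1) by simp
  show "t ^ l = 1" using assms(5) by (auto simp: power_divide)
  have "t \<noteq> 1" "t^2 \<noteq> 1" using assms(5) nz neq generic by (auto simp: power_divide simp flip: power_mult)
  moreover have "{0<..<3} = {1, 2::nat}" by auto
  ultimately show "\<forall>i\<in>{0<..<3}. t ^ i \<noteq> 1" by simp
qed (use assms l in auto)

lemma chain_append: "chain x cs y \<Longrightarrow> chain x (cs @ cs') y"
  by (induction cs arbitrary: y) simp_all

text \<open>Extra factors act on \<open>0\<close>. In the variants below, \<open>refl\<close>
  chooses them so that the progression continues.\<close>

lemma chain_pad: "chain x [p0, p1, p2] y \<Longrightarrow> chain x [p0, p1, p2, p3] y"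
  "chain x [p0, p1] y \<Longrightarrow> chain x [p0, p1, p2] y"
  "chain x [p0] y \<Longrightarrow> chain x [p0, p1] y"
  using chain_append[of x "[p0, p1, p2]" y "[p3]"] chain_append[of x "[p0, p1]" y "[p2]"] 
   chain_append[of x "[p0]" y "[p1]"] by simp_all

lemmas commute_short3 = commute_short[OF chain_pad(1) _ _ refl]
lemmas commute_short2 = commute_short3[OF chain_pad(2) _ refl]
lemmas commute_long2 = commute_long[OF chain_pad(2) _ refl]

lemma commute_self: "x ^ l * x = x * x ^ l" for x :: 'a
  by (rule power_commutes)

lemma commute_commute: "x * y = y * x \<Longrightarrow> x ^ l * y = y * x ^ l" for x y :: 'a
  by (rule power_commuting_commutes)

lemmas conv_simps = field_simps eval_nat_numeral nz
lemmas unity_simps = power_mult_distrib power_divide power_inverse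

lemma chain_1_add: "x * y = y * x + z \<Longrightarrow> chain x ps z \<Longrightarrow> chain x (1 # ps) y"
  by simp

lemma chain_1_diff: "x * y = y * x - p \<bullet> z \<Longrightarrow> chain x ps z \<Longrightarrow> chain x (1 # ps) y"
  using chain_scale[of x ps z "- p"] by simp

text \<open>The remainders run through the root string \<open>e\<close>, \<open>g\<close>,
  \<open>c\<close>, \<open>b\<close>, which the quartic Serre relation \<open>ab\<close>
  terminates.\<close>

lemma commute_a_e: "a ^ l * e = e * a ^ l"
proof (rule commute_short)
  show "chain a [s^3, r*s^2, r^2*s, r^3] e"
    by (rule chain_step[OF ae] chain_step[OF ag] chain_step[OF ac] chain_last[OF ab])+
  show "r / s = r / s \<or> r / s = s / r" by simp
qed (simp_all add: unity_simps, simp_all add: conv_simps)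

text \<open>\<open>w\<close> and \<open>w'\<close> have inverse twists, so each is killed by one of
  two common factors. That \<open>r / s\<close> and \<open>s / r\<close> differ needs
  \<open>r^2\<close> and \<open>s^2\<close> to differ.\<close>

lemma commute_a_f: "a ^ l * f = f * a ^ l"
proof (rule power_commute_chain)
  have "chain a [inverse (r / s), inverse (s / r)] w"
    by (rule chain_pad(3), rule chain_last'[OF wa]) (simp add: nz)
  moreover have "chain a [inverse (r / s), inverse (s / r)] w'"
    by (rule chain_Cons, rule chain_last'[OF w'a]) (simp add: nz)
  ultimately show "chain a [1, inverse (r / s), inverse (s / r)] f"
    by (intro chain_1_add[OF af[folded add_diff_eq]] chain_diff)
qed (use nz neq in \<open>auto simp: unity_simps l field_simps power2_eq_square\<close>)

lemma commute_e_a: "e ^ l * a = a * e ^ l"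
proof (rule commute_long2)
  show "chain e [inverse (s^3), inverse (r^3)] a"
    by (rule chain_step'[OF ae] chain_last'[OF ge])+ (simp_all add: nz)
  show "(s / r)^3 = (r / s)^3 \<or> (s / r)^3 = (s / r)^3" by simp
qed (simp_all add: unity_simps, simp_all add: conv_simps)

lemma commute_e_h: "e ^ l * h = h * e ^ l"
proof (rule power_commute_chain)
  have "chain e [s^3 / r^3, r^3 / s^3] v"
    by (rule chain_pad(3), rule chain_last[OF ev])
  moreover have "chain e [s^3 / r^3, r^3 / s^3] v'"
    by (rule chain_Cons, rule chain_last[OF ev'])
  ultimately show "chain e [1, s^3 / r^3, r^3 / s^3] h"
    by (intro chain_1_add[OF eh[folded add_diff_eq]] chain_diff)
  have "r^3 * r^3 = r^6" "s^3 * s^3 = s^6" by (simp_all flip: power_add)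
  then show "distinct [1, s^3 / r^3, r^3 / s^3]"
    using nz neq generic by (auto simp: field_simps)
qed (use l in \<open>auto simp: unity_simps\<close>)

lemma chain_g_a: "chain g [inverse (r*s^2), inverse (r^2*s), inverse (r^3)] a"
  by (rule chain_step'[OF ag] chain_step'[OF cg] chain_last'[OF dg])+ (simp_all add: nz)

lemma commute_g_a: "g ^ l * a = a * g ^ l"
proof (rule commute_short3[OF chain_g_a])
  show "s / r = r / s \<or> s / r = s / r" by simp
qed (simp_all add: unity_simps, simp_all add: conv_simps)

lemma commute_g_e: "g ^ l * e = e * g ^ l"
  by (rule commute_long2[OF chain_pad(3), OF chain_last[OF ge] refl _ disjI1[OF refl]]) simp

lemma commute_g_f: "g ^ l * f = f * g ^ l"
proof (rule commute_short2)
  show "chain g [1, r^3 / (r^2 * s)] f"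
    using chain_mult_right[OF w'g _ chain_last[OF ge]] nz by (intro chain_1_diff[OF gf]) simp
  show "r / s = r / s \<or> r / s = s / r" by simp
qed (simp_all add: conv_simps)

text \<open>The remainder is a multiple of \<open>v * a\<close>, so the chain of \<open>a\<close> is
  reused, rescaled by the twist \<open>s^3\<close> of \<open>v\<close>; the leading \<open>1\<close>
  then fits the progression of powers of \<open>s / r\<close>.\<close>

lemma commute_g_h: "g ^ l * h = h * g ^ l"
proof (rule commute_short)
  show "chain g [1, s^3 * inverse (r*s^2), s^3 * inverse (r^2*s), s^3 * inverse (r^3)] h"
    using chain_mult_left[OF gv chain_g_a]
    by (intro chain_1_add[OF gh] chain_scale) (simp only: list.map)
  show "s / r = r / s \<or> s / r = s / r" by simp
qed (simp_all add: conv_simps)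

lemma chain_c_a: "chain c [inverse (r^2*s), inverse (r^3)] a"
  by (rule chain_step'[OF ac] chain_last'[OF bc])+ (simp_all add: nz)

lemma commute_c_a: "c ^ l * a = a * c ^ l"
proof (rule commute_short2[OF chain_c_a])
  show "s / r = r / s \<or> s / r = s / r" by simp
qed (simp_all add: unity_simps, simp_all add: conv_simps)

text \<open>Moving \<open>c\<close> across a product turns one \<open>g\<close> at a time into
  \<open>d\<close>, and with \<open>d\<close> it commutes up to a scalar.\<close>

lemma chain_c_gg: "chain c [r^4*s^2, r^5*s, r^6] (g * g)"
proof (rule chain_step)
  show "c * (g * g) = (r^4*s^2) \<bullet> (g * g * c) + (r^2*s + r^3) \<bullet> (g * d)"
    by (simp add: cg cg' dg exp_simps)
  show "chain c [r^5*s, r^6] ((r^2*s + r^3) \<bullet> (g * d))"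
  proof (rule chain_scale, rule chain_step)
    show "c * (g * d) = (r^5*s) \<bullet> (g * d * c) + d * d"
      by (simp add: cd cg' exp_simps)
    show "chain c [r^6] (d * d)"
      by (rule chain_last) (simp add: cd cd' exp_simps)
  qed
qed

lemma commute_c_e: "c ^ l * e = e * c ^ l"
proof (rule commute_short)
  show "chain c [r^3*s^3, r^4*s^2, r^5*s, r^6] e"
    by (rule chain_step[OF ce] chain_scale chain_c_gg)+
  show "r / s = r / s \<or> r / s = s / r" by simp
qed (simp_all add: unity_simps, simp_all add: conv_simps)

lemma commute_c_f: "c ^ l * f = f * c ^ l"
proof (rule commute_short3)
  have "chain c [r^2*s, r^3] g"
    by (rule chain_step[OF cg] chain_last[OF cd])+
  from chain_mult_right[OF w'c _ this]
  show "chain c [1, (r^2*s) / (r*s^2), r^3 / (r*s^2)] f"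
    using nz by (intro chain_1_diff[OF cf]) simp
  show "r / s = r / s \<or> r / s = s / r" by simp
qed (simp_all add: conv_simps)

lemma commute_c_h: "c ^ l * h = h * c ^ l"
proof (rule commute_short)
  \<comment> \<open>Mirror image of \<open>chain_c_gg\<close>: now each \<open>a\<close> in turn
    becomes \<open>b\<close>.\<close>
  have aac: "a * a * c = (r^4*s^2) \<bullet> (c * (a * a)) + (r^3 + r^2*s) \<bullet> (b * a)"
    by (simp add: ac ac' ab exp_simps)
  have bac: "b * a * c = (r^5*s) \<bullet> (c * (b * a)) + b * b"
    by (simp add: ac ac' bc bc' exp_simps)
  have bbc: "b * b * c = r^6 \<bullet> (c * (b * b))"
    by (simp add: bc bc' exp_simps)
  have "chain c [inverse (r^4*s^2), inverse (r^5*s), inverse (r^6)] (a * a)"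
    by (rule chain_step'[OF aac] chain_scale chain_step'[OF bac] chain_last'[OF bbc])+
      (simp_all add: nz)
  from chain_mult_left[OF cv this]
  show "chain c [1, r^3*s^3 * inverse (r^4*s^2), r^3*s^3 * inverse (r^5*s), r^3*s^3 * inverse (r^6)] h"
    by (intro chain_1_add[OF ch] chain_scale) (simp only: list.map)
  show "s / r = r / s \<or> s / r = s / r" by simp
qed (simp_all add: conv_simps)

lemma commute_b_a: "b ^ l * a = a * b ^ l"
  by (rule commute_long2[OF chain_pad(3), OF chain_last'[OF ab] refl _ disjI1[OF refl]])
    (simp_all add: nz unity_simps)

lemma b_ccc: "chain b [r^9] (c * (c * c))"
  by (rule chain_last) (simp add: bc bc' exp_simps)

text \<open>Both remainders, \<open>g * c\<close> and \<open>d\<close>, have the scalar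
  \<open>r^6*s^3\<close> and leave a multiple of the cube of \<open>c\<close>, so they share one
  chain.\<close>

lemma commute_b_e: "b ^ l * e = e * b ^ l"
proof (rule commute_long)
  have gc: "b * (g * c) = (r^6*s^3) \<bullet> (g * c * b) + k \<bullet> (c * (c * c))"
    by (simp add: bg' bc exp_simps)
  have "chain b [r^6*s^3, r^9] ((r^2*s*(r^3-s^3)) \<bullet> (g * c) + (r^3 - r*s^2-r^2*s) \<bullet> d)"
    by (intro chain_add chain_scale chain_step[OF gc] chain_step[OF bd] b_ccc)
  then show "chain b [r^3*s^6, r^6*s^3, r^9] e"
    by (rule chain_step[OF be[unfolded add.assoc]])
  show "(r / s)^3 = (r / s)^3 \<or> (r / s)^3 = (s / r)^3" by simp
qed (simp_all add: unity_simps, simp_all add: conv_simps)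

lemma commute_b_f: "b ^ l * f = f * b ^ l"
proof (rule commute_long2)
  show "chain b [1, r^3 / s^3] f"
    using chain_mult_right[OF w'b _ chain_last[OF bc]] nz by (intro chain_1_diff[OF bf]) simp
  show "(r / s)^3 = (r / s)^3 \<or> (r / s)^3 = (s / r)^3" by simp
qed (simp_all add: conv_simps)

lemma commute_b_h: "b ^ l * h = h * b ^ l"
proof (rule commute_long2)
  have aaab: "a * (a * a) * b = r^9 \<bullet> (b * (a * (a * a)))"
    by (simp add: ab ab' exp_simps)
  have "chain b [inverse (r^9)] (a * (a * a))"
    by (rule chain_last'[OF aaab]) (simp add: nz)
  from chain_mult_left[OF bv this]
  show "chain b [1, r^6*s^3 * inverse (r^9)] h"
    by (intro chain_1_add[OF bh] chain_scale) (simp only: list.map)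
  show "(s / r)^3 = (r / s)^3 \<or> (s / r)^3 = (s / r)^3" by simp
qed (simp_all add: conv_simps)

lemma chain_d_a: "chain d [inverse (r^3*s^3), inverse (r^6)] a"
proof -
  have "c * c * d = r^6 \<bullet> (d * (c * c))" by (simp add: cd cd' exp_simps)
  then have "chain d [inverse (r^6)] (k \<bullet> (c * c))"
    by (rule chain_scale[OF chain_last']) (simp add: nz)
  then show ?thesis by (rule chain_step'[OF ad]) (simp add: nz)
qed

lemma commute_d_a: "d ^ l * a = a * d ^ l"
proof (rule commute_long2[OF chain_d_a])
  show "(s / r)^3 = (r / s)^3 \<or> (s / r)^3 = (s / r)^3" by simp
qed (simp_all add: unity_simps, simp_all add: conv_simps)

lemma commute_d_e: "d ^ l * e = e * d ^ l"
proof (rule commute_long2)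
  have "chain d [r^9] (g * (g * g))"
    by (rule chain_last) (simp add: dg dg' exp_simps)
  then show "chain d [r^6*s^3, r^9] e"
    by (rule chain_step[OF de chain_scale])
  show "(r / s)^3 = (r / s)^3 \<or> (r / s)^3 = (s / r)^3" by simp
qed (simp_all add: unity_simps, simp_all add: conv_simps)

lemma commute_d_f: "d ^ l * f = f * d ^ l"
proof (rule commute_long2)
  have gg: "chain d [r^6] (g * g)"
    by (rule chain_last) (simp add: dg dg' exp_simps)
  have "chain d [r^6 / (r^3*s^3)] (g * (g * w'))"
    using chain_mult_right[OF w'd _ gg] nz by (simp only: mult.assoc list.map) simp
  then show "chain d [1, r^6 / (r^3*s^3)] f"
    by (rule chain_1_diff[OF df])
  show "(r / s)^3 = (r / s)^3 \<or> (r / s)^3 = (s / r)^3" by simp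
qed (simp_all add: conv_simps)

lemma commute_d_h: "d ^ l * h = h * d ^ l"
proof (rule commute_long)
  have ccc: "c * (c * c) * d = r^9 \<bullet> (d * (c * (c * c)))"
    by (simp add: cd cd' exp_simps)
  have ca: "c * a * d = (r^6*s^3) \<bullet> (d * (c * a)) + k \<bullet> (c * (c * c))"
    by (simp add: ad cd' exp_simps)
  \<comment> \<open>\<open>c * a\<close> and \<open>b\<close> share this chain, which therefore
    kills every combination, in particular the one in \<open>dh\<close>.\<close>
  have "chain d [inverse (r^6*s^3), inverse (r^9)] 
    ((r^3 - s^3) \<bullet> (p \<bullet> (c * a) + q \<bullet> b))" for p q
    by (intro chain_scale chain_add chain_step'[OF ca] chain_step'[OF bd] chain_last'[OF ccc])
      (simp_all add: nz)
  from chain_mult_left[OF dv this]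
  show "chain d [1, r^3*s^6 * inverse (r^6*s^3), r^3*s^6 * inverse (r^9)] h"
    by (intro chain_1_add[OF dh]) (simp only: list.map)
  show "(s / r)^3 = (r / s)^3 \<or> (s / r)^3 = (s / r)^3" by simp
qed (simp_all add: conv_simps)

theorem root_power_commutes:
  assumes "x \<in> {a, b, c, d, g, e}" "y \<in> {a, e, f, h}"
  shows "x ^ l * y = y * x ^ l"
  using assms commute_a_e commute_a_f commute_commute[OF ah] commute_self
    commute_e_a commute_commute[OF ef] commute_e_h
    commute_g_a commute_g_e commute_g_f commute_g_h commute_c_a commute_c_e commute_c_f commute_c_h
    commute_b_a commute_b_e commute_b_f commute_b_h commute_d_a commute_d_e commute_d_f commute_d_h
  by (elim insertE emptyE) (simp_all only:)

end

section \<open>The defining relations and the opposite algebra\<close>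

context kalg
begin

definition bracket :: "'k \<Rightarrow> 'a \<Rightarrow> 'a \<Rightarrow> 'a" where
  "bracket c x y = x * y - c \<bullet> (y * x)"

text \<open>Kept generic in the algebra and the parameters, to be used also in the opposite algebra
  with \<open>r\<close> and \<open>s\<close> exchanged.\<close>

fun root_vec :: "'k \<Rightarrow> 'k \<Rightarrow> 'a \<Rightarrow> 'a \<Rightarrow> pos_root \<Rightarrow> 'a" where
  "root_vec r s x y R1 = x"
| "root_vec r s x y R2 = y"
| "root_vec r s x y R12 = bracket (s^3) x y"
| "root_vec r s x y R112 = bracket (r * s^2) x (bracket (s^3) x y)"
| "root_vec r s x y R1112 = bracket (r^2 * s) x (bracket (r * s^2) x (bracket (s^3) x y))"
| "root_vec r s x y R11212 =
     bracket (r^2 * s) (bracket (r * s^2) x (bracket (s^3) x y)) (bracket (s^3) x y)"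

lemma twist_power:
  assumes "w * x = p \<bullet> (x * w)"
  shows "w * x ^ n = p ^ n \<bullet> (x ^ n * w)"
proof (induction n)
  case (Suc n)
  have "w * x ^ Suc n = p \<bullet> (x * (w * x ^ n))"
    using assms by (simp add: scale_mult_left flip: mult.assoc)
  also have "\<dots> = p ^ Suc n \<bullet> (x ^ Suc n * w)"
    by (simp add: Suc scale_mult_right mult.assoc)
  finally show ?case .
qed simp

lemma twist_power':
  assumes "w * x = p \<bullet> (x * w)"
  shows "w ^ n * x = p ^ n \<bullet> (x * w ^ n)"
proof (induction n)
  case (Suc n)
  have "w ^ Suc n * x = w * (w ^ n * x)" by (simp add: mult.assoc)
  also have "\<dots> = p ^ n \<bullet> (w * x * w ^ n)" by (simp add: Suc scale_mult_right mult.assoc)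
  also have "\<dots> = p ^ Suc n \<bullet> (x * w ^ Suc n)"
    unfolding assms by (simp add: scale_mult_left mult.assoc mult.commute)
  finally show ?case .
qed simp

lemma power_commute_twist: 
  assumes "w * x = p \<bullet> (x * w)" "p ^ l = 1"
  shows "x ^ l * w = w * x ^ l" "w ^ l * x = x * w ^ l"
  using twist_power[OF assms(1), of l] twist_power'[OF assms(1), of l] assms(2) by simp_all

lemma twist_bracket:
  assumes "\<exists>p. w * x = p \<bullet> (x * w) \<and> p ^ l = 1" "\<exists>q. w * y = q \<bullet> (y * w) \<and> q ^ l = 1"
  shows "\<exists>p. w * bracket c x y = p \<bullet> (bracket c x y * w) \<and> p ^ l = 1"
proof -
  obtain p q where "w * x = p \<bullet> (x * w)" "w * y = q \<bullet> (y * w)" and l: "p ^ l = 1" "q ^ l = 1"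
    using assms by blast
  then have "w * bracket c x y = (p * q) \<bullet> (bracket c x y * w)"
    by (simp add: bracket_def kalg_simps assoc_rule[of w])
  then show ?thesis using l by (metis power_mult_distrib mult_1)
qed

text \<open>Root vectors are iterated brackets, so a twist of \<open>x\<close> and \<open>y\<close>
  by \<open>l\<close>-th roots of unity passes to them.\<close>

lemma root_vec_twist:
  assumes "w * x = p \<bullet> (x * w)" "w * y = q \<bullet> (y * w)" "p ^ l = 1" "q ^ l = 1"
  shows "root_vec r s x y \<alpha> ^ l * w = w * root_vec r s x y \<alpha> ^ l"
proof -
  have 1: "\<exists>p. w * x = p \<bullet> (x * w) \<and> p ^ l = 1" "\<exists>q. w * y = q \<bullet> (y * w) \<and> q ^ l = 1"
    using assms by blast+
  then have "\<exists>p. w * root_vec r s x y \<alpha> = p \<bullet> (root_vec r s x y \<alpha> * w) \<and> p ^ l = 1"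
    by (cases \<alpha>) (simp_all only: root_vec.simps twist_bracket)
  then show ?thesis using power_commute_twist(1) by blast
qed

end

lemma pairing_nz: "r \<noteq> 0 \<Longrightarrow> s \<noteq> 0 \<Longrightarrow> pairing r s i j \<noteq> 0"
  by (cases i; cases j) simp_all

text \<open>Torus relations appear as twists without inverses: in the intended model the unit of the
  quantum group is not the unit of the ring.\<close>

locale UG2_relations = kalg scale for scale :: "'k::field \<Rightarrow> 'a::ring_1 \<Rightarrow> 'a" (infixr "\<bullet>" 75) +
  fixes r s :: 'k and x y t t' :: "idx \<Rightarrow> 'a"
  assumes nz: "r \<noteq> 0" "s \<noteq> 0" and generic: "r ^ 3 \<noteq> s ^ 3" "r ^ 4 \<noteq> s ^ 4" "r ^ 2 - r * s + s ^ 2 \<noteq> 0"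
    and tx: "t j * x i = pairing r s i j \<bullet> (x i * t j)"
    and t'x: "t' j * x i = inverse (pairing r s j i) \<bullet> (x i * t' j)"
    and xy: "x i * y j = y j * x i + (if i = j then inverse (param r i - param s i) \<bullet> (t i - t' i) else 0)"
    and serre2: "x I2^2 * x I1 - (inverse (r^3) + inverse (s^3)) \<bullet> (x I2 * x I1 * x I2)
        + inverse ((r * s)^3) \<bullet> (x I1 * x I2^2) = 0"
    and serre4: "x I1^4 * x I2 - ((r + s) * (r^2 + s^2)) \<bullet> (x I1^3 * x I2 * x I1)
        + (r * s * (r^2 + s^2) * (r^2 + r * s + s^2)) \<bullet> (x I1^2 * x I2 * x I1^2)
        - ((r * s)^3 * (r + s) * (r^2 + s^2)) \<bullet> (x I1 * x I2 * x I1^3)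
        + (r * s)^6 \<bullet> (x I2 * x I1^4) = 0"
begin

abbreviation root where "root \<equiv> root_vec r s (x I1) (x I2)"

lemma x2_root12: "root R12 * x I2 = r^3 \<bullet> (x I2 * root R12)"
proof -
  have "root R12 * x I2 - r^3 \<bullet> (x I2 * root R12) = (r * s)^3 \<bullet> (x I2^2 * x I1 - (inverse (r^3) + inverse (s^3)) \<bullet> (x I2 * x I1 * x I2)
        + inverse ((r * s)^3) \<bullet> (x I1 * x I2^2))"
    using nz by (simp add: bracket_def kalg_simps power2_eq_square)
  then show ?thesis using serre2 by simp
qed

text \<open>The coefficients of the quartic relation are the elementary symmetric functions of
  \<open>s^3\<close>, \<open>r * s^2\<close>, \<open>r^2 * s\<close>, \<open>r^3\<close>, so its
  left side is an iterated bracket with these scalars.\<close>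

lemma x1_root1112: "x I1 * root R1112 = r^3 \<bullet> (root R1112 * x I1)"
proof -
  have "x I1 * root R1112 - r^3 \<bullet> (root R1112 * x I1) =
    x I1^4 * x I2 - ((r + s) * (r^2 + s^2)) \<bullet> (x I1^3 * x I2 * x I1)
        + (r * s * (r^2 + s^2) * (r^2 + r * s + s^2)) \<bullet> (x I1^2 * x I2 * x I1^2)
        - ((r * s)^3 * (r + s) * (r^2 + s^2)) \<bullet> (x I1 * x I2 * x I1^3)
        + (r * s)^6 \<bullet> (x I2 * x I1^4)"
    using [[simproc del: int_combine_numerals field_combine_numerals]]
    by (simp add: bracket_def kalg_simps power2_eq_square power3_eq_cube eval_nat_numeral)
  then show ?thesis using serre4 by simp
qed

lemma root_power_commutes:
  assumes "l > 0" "r ^ l = 1" "s ^ l = 1"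
  shows "root \<alpha> ^ l * x i = x i * root \<alpha> ^ l" "root \<alpha> ^ l * y i = y i * root \<alpha> ^ l"
proof -
  have "r^4 - s^4 = (r + s) * (r^2 + s^2) * (r - s)"
    by (simp add: algebra_simps eval_nat_numeral)
  with generic(2) have nz': "r + s \<noteq> 0" "r^2 + s^2 \<noteq> 0" by auto
  let ?c1 = "inverse (r - s)" and ?c2 = "inverse (r^3 - s^3)"
  interpret G2_root_vectors_at_roots_of_unity r s "r * (r^3 - s^3) / (r + s)" "x I1" "root R1112" "root R112"
    "root R11212" "x I2" "root R12" "y I1" "y I2" "?c1 \<bullet> t I1" "?c1 \<bullet> t' I1" "?c2 \<bullet> t I2" "?c2 \<bullet> t' I2" scale l
  proof unfold_locales
    have tx': "x i * t j = inverse (pairing r s i j) \<bullet> (t j * x i)" for i j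
      using pairing_nz[OF nz, of i j] by (simp add: tx)
    have t'x': "x i * t' j = pairing r s j i \<bullet> (t' j * x i)" for i j
      using pairing_nz[OF nz, of j i] by (simp add: t'x)
    show "x I1 * (?c2 \<bullet> t I2) = r^3 \<bullet> ((?c2 \<bullet> t I2) * x I1)"
      "x I2 * (?c2 \<bullet> t I2) = (s^3 / r^3) \<bullet> ((?c2 \<bullet> t I2) * x I2)"
      by (simp_all add: tx' kalg_simps field_simps)
    show "x I1 * (?c2 \<bullet> t' I2) = s^3 \<bullet> ((?c2 \<bullet> t' I2) * x I1)"
      "x I2 * (?c2 \<bullet> t' I2) = (r^3 / s^3) \<bullet> ((?c2 \<bullet> t' I2) * x I2)"
      by (simp_all add: t'x' kalg_simps field_simps)
    show "root R12 * x I2 = r^3 \<bullet> (x I2 * root R12)" by (rule x2_root12)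
    show "x I1 * root R1112 = r^3 \<bullet> (root R1112 * x I1)" by (rule x1_root1112)
    show "x I1 * x I2 = s^3 \<bullet> (x I2 * x I1) + root R12"
      "x I1 * root R12 = (r * s^2) \<bullet> (root R12 * x I1) + root R112"
      "x I1 * root R112 = (r^2 * s) \<bullet> (root R112 * x I1) + root R1112"
      "root R112 * root R12 = (r^2 * s) \<bullet> (root R12 * root R112) + root R11212"
      by (simp_all add: bracket_def)
  qed (use nz nz' generic assms in \<open>simp_all add: xy tx t'x kalg_simps field_simps\<close>)
  have "root \<alpha> \<in> {x I1, root R1112, root R112, root R11212, root R12, x I2}" by (cases \<alpha>) auto
  moreover have "x i \<in> {x I1, x I2, y I1, y I2}" "y i \<in> {x I1, x I2, y I1, y I2}" by (cases i; simp)+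
  ultimately show "root \<alpha> ^ l * x i = x i * root \<alpha> ^ l" "root \<alpha> ^ l * y i = y i * root \<alpha> ^ l"
    using root_power_commutes by blast+
qed

end

text \<open>A type has one ring structure as a class instance, so the reversed product needs a copy
  of the type.\<close>

typedef 'a opp = "UNIV :: 'a set" morphisms of_opp to_opp ..

setup_lifting type_definition_opp

instantiation opp :: (ring_1) ring_1
begin

lift_definition zero_opp :: "'a opp" is 0 .
lift_definition one_opp :: "'a opp" is 1 .
lift_definition plus_opp :: "'a opp \<Rightarrow> 'a opp \<Rightarrow> 'a opp" is "(+)" .
lift_definition minus_opp :: "'a opp \<Rightarrow> 'a opp \<Rightarrow> 'a opp" is "(-)" .
lift_definition uminus_opp :: "'a opp \<Rightarrow> 'a opp" is "uminus" .
lift_definition times_opp :: "'a opp \<Rightarrow> 'a opp \<Rightarrow> 'a opp" is "\<lambda>x y. y * x" .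

instance by standard (transfer; simp add: algebra_simps)+

end

lemma to_opp_add: "to_opp (x + y) = to_opp x + to_opp y" by transfer simp
lemma to_opp_diff: "to_opp (x - y) = to_opp x - to_opp y" by transfer simp
lemma to_opp_mult: "to_opp (x * y) = to_opp y * to_opp x" by transfer simp
lemma to_opp_1: "to_opp 1 = 1" by transfer simp
lemma to_opp_0: "to_opp 0 = 0" by transfer simp
lemma to_opp_power: "to_opp (x ^ n) = to_opp x ^ n"
  by (induction n) (simp_all add: to_opp_1 to_opp_mult power_commutes)
lemma to_opp_inject': "to_opp x = to_opp y \<longleftrightarrow> x = y" by (simp add: to_opp_inject)

lift_definition scale_opp :: "('k \<Rightarrow> 'a \<Rightarrow> 'a) \<Rightarrow> 'k \<Rightarrow> 'a opp \<Rightarrow> 'a opp" is "\<lambda>f. f" .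

lemma to_opp_scale: "to_opp (f c x) = scale_opp f c (to_opp x)" by transfer simp

lemma kalg_opp:
  fixes scale :: "'k::field \<Rightarrow> 'a::ring_1 \<Rightarrow> 'a"
  assumes "kalg scale" shows "kalg (scale_opp scale)"
proof -
  interpret kalg scale by fact
  show ?thesis
  proof
    fix c d and x y :: "'a opp"
    obtain x' y' where [simp]: "x = to_opp x'" "y = to_opp y'" by (metis of_opp_inverse)
    note [simp] = to_opp_add[symmetric] to_opp_mult[symmetric] to_opp_scale[symmetric]
    show "scale_opp scale c (x + y) = scale_opp scale c x + scale_opp scale c y"
      by (simp add: scale_right_distrib)
    show "scale_opp scale (c + d) x = scale_opp scale c x + scale_opp scale d x"
      by (simp add: scale_left_distrib)
    show "scale_opp scale c (scale_opp scale d x) = scale_opp scale (c * d) x" "scale_opp scale 1 x = x"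
      by simp_all
    show "scale_opp scale c x * y = scale_opp scale c (x * y)"
      "x * scale_opp scale c y = scale_opp scale c (x * y)"
      by (simp_all add: scale_mult_left scale_mult_right)
  qed
qed

section \<open>Quotients by two-sided ideals as a type\<close>

text \<open>A quotient by an ideal that depends on parameters is not a type. The product of the quotients by
  all two-sided ideals is one, and it contains each of them as a non-unital subring.\<close>

definition two_sided_ideal :: "'a::ring_1 set \<Rightarrow> bool" where
  "two_sided_ideal J \<longleftrightarrow> 0 \<in> J \<and> (\<forall>x\<in>J. \<forall>y\<in>J. x + y \<in> J) \<and> (\<forall>x\<in>J. \<forall>a. a * x \<in> J \<and> x * a \<in> J)"

lemma two_sided_idealD:
  assumes "two_sided_ideal J"
  shows "0 \<in> J" "x \<in> J \<Longrightarrow> y \<in> J \<Longrightarrow> x + y \<in> J" "x \<in> J \<Longrightarrow> a * x \<in> J" "x \<in> J \<Longrightarrow> x * a \<in> J"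
    "x \<in> J \<Longrightarrow> - x \<in> J" "x \<in> J \<Longrightarrow> y \<in> J \<Longrightarrow> x - y \<in> J"
proof -
  show *: "0 \<in> J" "x \<in> J \<Longrightarrow> y \<in> J \<Longrightarrow> x + y \<in> J" "x \<in> J \<Longrightarrow> a * x \<in> J" "x \<in> J \<Longrightarrow> x * a \<in> J" for x y a
    using assms by (auto simp: two_sided_ideal_def)
  show neg: "x \<in> J \<Longrightarrow> - x \<in> J" for x
    using *(3)[of x "- 1"] by simp
  show "x \<in> J \<Longrightarrow> y \<in> J \<Longrightarrow> x - y \<in> J"
    using *(2)[of x "- y"] neg by simp
qed

text \<open>Coordinates at sets that are not ideals are ignored; the classes are thus the elements
  of the product of all quotients.\<close>

definition quots_rel :: "('a::ring_1 set \<Rightarrow> 'a) \<Rightarrow> ('a set \<Rightarrow> 'a) \<Rightarrow> bool" where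
  "quots_rel f g \<longleftrightarrow> (\<forall>J. two_sided_ideal J \<longrightarrow> f J - g J \<in> J)"

lemma quots_relI: "(\<And>J. two_sided_ideal J \<Longrightarrow> f J - g J \<in> J) \<Longrightarrow> quots_rel f g"
  by (simp add: quots_rel_def)

lemma quots_relD: "quots_rel f g \<Longrightarrow> two_sided_ideal J \<Longrightarrow> f J - g J \<in> J"
  by (simp add: quots_rel_def)

lemma quots_rel_refl: "(\<And>J. f J = g J) \<Longrightarrow> quots_rel f g"
  by (simp add: quots_rel_def two_sided_idealD)

quotient_type (overloaded) 'a quots = "'a::ring_1 set \<Rightarrow> 'a" / quots_rel
proof (rule equivpI)
  show "reflp (quots_rel :: ('a set \<Rightarrow> 'a) \<Rightarrow> _)" by (auto intro: reflpI quots_rel_refl)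
  show "symp (quots_rel :: ('a set \<Rightarrow> 'a) \<Rightarrow> _)"
  proof (intro sympI quots_relI)
    fix f g :: "'a set \<Rightarrow> 'a" and J :: "'a set" assume "quots_rel f g" "two_sided_ideal J"
    then show "g J - f J \<in> J" using two_sided_idealD(5)[of J "f J - g J"] quots_relD by fastforce
  qed
  show "transp (quots_rel :: ('a set \<Rightarrow> 'a) \<Rightarrow> _)"
  proof (intro transpI quots_relI)
    fix f g h :: "'a set \<Rightarrow> 'a" and J :: "'a set" assume "quots_rel f g" "quots_rel g h" "two_sided_ideal J"
    then show "f J - h J \<in> J"
      using two_sided_idealD(2)[of J "f J - g J" "g J - h J"] quots_relD by fastforce
  qed
qed

instantiation quots :: (ring_1) ring_1
begin

lift_definition zero_quots :: "'a quots" is "\<lambda>_. 0" .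
lift_definition one_quots :: "'a quots" is "\<lambda>_. 1" .

lift_definition plus_quots :: "'a quots \<Rightarrow> 'a quots \<Rightarrow> 'a quots" is "\<lambda>f g J. f J + g J"
proof (intro quots_relI)
  fix f f' g g' :: "'a set \<Rightarrow> 'a" and J :: "'a set"
  assume "quots_rel f f'" "quots_rel g g'" and J: "two_sided_ideal J"
  then have "(f J - f' J) + (g J - g' J) \<in> J" by (intro two_sided_idealD quots_relD)
  then show "(f J + g J) - (f' J + g' J) \<in> J" by (simp add: algebra_simps)
qed

lift_definition minus_quots :: "'a quots \<Rightarrow> 'a quots \<Rightarrow> 'a quots" is "\<lambda>f g J. f J - g J"
proof (intro quots_relI)
  fix f f' g g' :: "'a set \<Rightarrow> 'a" and J :: "'a set"
  assume "quots_rel f f'" "quots_rel g g'" and J: "two_sided_ideal J"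
  then have "(f J - f' J) - (g J - g' J) \<in> J" by (intro two_sided_idealD quots_relD)
  then show "(f J - g J) - (f' J - g' J) \<in> J" by (simp add: algebra_simps)
qed

lift_definition uminus_quots :: "'a quots \<Rightarrow> 'a quots" is "\<lambda>f J. - f J"
proof (intro quots_relI)
  fix f f' :: "'a set \<Rightarrow> 'a" and J :: "'a set"
  assume "quots_rel f f'" and J: "two_sided_ideal J"
  then have "- (f J - f' J) \<in> J" by (intro two_sided_idealD quots_relD)
  then show "- f J - - f' J \<in> J" by (simp add: algebra_simps)
qed

lift_definition times_quots :: "'a quots \<Rightarrow> 'a quots \<Rightarrow> 'a quots" is "\<lambda>f g J. f J * g J"
proof (intro quots_relI)
  fix f f' g g' :: "'a set \<Rightarrow> 'a" and J :: "'a set"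
  assume "quots_rel f f'" "quots_rel g g'" and J: "two_sided_ideal J"
  then have "f J * (g J - g' J) + (f J - f' J) * g' J \<in> J" by (intro two_sided_idealD quots_relD)
  then show "f J * g J - f' J * g' J \<in> J" by (simp add: algebra_simps)
qed

instance
proof
  show "(0::'a quots) \<noteq> 1"
  proof transfer
    \<comment> \<open>The class \<open>ring_1\<close> demands that 0 and 1 differ. The component at
      the zero ideal, the ring itself, guarantees this even though other components may be
      trivial.\<close>
    have "two_sided_ideal {0::'a}" by (simp add: two_sided_ideal_def)
    then show "\<not> quots_rel (\<lambda>_::'a set. 0) (\<lambda>_. 1)" by (fastforce simp: quots_rel_def)
  qed
qed (transfer; rule quots_rel_refl; simp add: algebra_simps)+

end

text \<open>Embeds a single quotient, with zero in all other components. The image of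
  \<open>1\<close> is only an idempotent, hence \<open>n > 0\<close> in
  \<open>at_ideal_power\<close>.\<close>

lift_definition at_ideal :: "'a::ring_1 set \<Rightarrow> 'a \<Rightarrow> 'a quots" is "\<lambda>I p J. if J = I then p else 0" .

lemma at_ideal_add: "at_ideal I (p + q) = at_ideal I p + at_ideal I q"
  by transfer (rule quots_rel_refl, simp)

lemma at_ideal_diff: "at_ideal I (p - q) = at_ideal I p - at_ideal I q"
  by transfer (rule quots_rel_refl, simp)

lemma at_ideal_0: "at_ideal I 0 = 0"
  by transfer (rule quots_rel_refl, simp)

lemma at_ideal_mult: "at_ideal I (p * q) = at_ideal I p * at_ideal I q"
  by transfer (rule quots_rel_refl, simp)

lemma at_ideal_power: "n > 0 \<Longrightarrow> at_ideal I (p ^ n) = at_ideal I p ^ n"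
  by (induction n rule: nat_induct_non_zero) (simp_all add: at_ideal_mult)

lemma at_ideal_eq_iff: "two_sided_ideal I \<Longrightarrow> at_ideal I p = at_ideal I q \<longleftrightarrow> p - q \<in> I"
  by transfer (auto simp: quots_rel_def two_sided_idealD)

lift_definition const_quots :: "'a::ring_1 \<Rightarrow> 'a quots" is "\<lambda>p _. p" .

lemma const_quots_hom:
  "const_quots (p + q) = const_quots p + const_quots q"
  "const_quots (p * q) = const_quots p * const_quots q" "const_quots 1 = 1"
  by (transfer; rule quots_rel_refl; simp)+

lemma const_quots_central: "(\<And>q. p * q = q * p) \<Longrightarrow> const_quots p * x = x * const_quots p"
  by transfer (rule quots_rel_refl, blast)

lemma at_ideal_const_mult: "at_ideal I (p * q) = const_quots p * at_ideal I q"
  by transfer (rule quots_rel_refl, simp)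

definition scale_quots :: "'k::field \<Rightarrow> ('x, 'k) free_alg quots \<Rightarrow> ('x, 'k) free_alg quots" where
  "scale_quots c x = const_quots (Poly_Mapping.single 0 c) * x"

lemma at_ideal_scale: "at_ideal I (c \<cdot> p) = scale_quots c (at_ideal I p)"
  by (simp add: scale_free_def scale_quots_def at_ideal_const_mult)

lemma poly_mapping_single_induct [case_names zero single_add]:
  assumes "P 0" and "\<And>p k c. P p \<Longrightarrow> P (p + Poly_Mapping.single k c)"
  shows "P p"
proof (induction p rule: Poly_Mapping.update_induct)
  case (update p k c)
  have "Poly_Mapping.update k c p = p + Poly_Mapping.single k c"
    using update(1) by (intro poly_mapping_eqI) (auto simp: lookup_add lookup_single lookup_update in_keys_iff when_def)
  then show ?case using assms(2) update by simp
qed fact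

lemma single_0_central:
  fixes p :: "('x, 'k::field) free_alg"
  shows "Poly_Mapping.single 0 c * p = p * Poly_Mapping.single 0 c"
  by (induction p rule: poly_mapping_single_induct)
    (simp_all add: distrib_left distrib_right mult_single mult.commute)

lemma two_sided_ideal_UG2_ideal: "two_sided_ideal (UG2_ideal r s)"
proof -
  interpret ideal "UG2_ideal r s" free_ring by (rule ideal_UG2_ideal)
  show ?thesis
    using additive_subgroup.zero_closed[OF is_additive_subgroup] additive_subgroup.a_closed[OF is_additive_subgroup] I_l_closed I_r_closed
    by (simp add: two_sided_ideal_def ring_of_type_algebra_def)
qed

section \<open>Classes and central elements in \<open>UG2\<close>\<close>

lemma carrier_free_ring: "carrier free_ring = UNIV"
  by (simp add: ring_of_type_algebra_def)

lemma minus_free_ring: "p \<ominus>\<^bsub>free_ring\<^esub> q = p - (q :: ('x, 'k::field) free_alg)"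
proof -
  interpret ring "free_ring :: ('x, 'k) free_alg ring" by (rule ring_free_ring)
  have "\<ominus>\<^bsub>free_ring\<^esub> q = - q"
    by (rule minus_equality) (simp_all add: ring_of_type_algebra_def)
  then show ?thesis by (simp add: a_minus_def) (simp add: ring_of_type_algebra_def)
qed

lemma UG2_class_eq_iff: "UG2_class r s p = UG2_class r s q \<longleftrightarrow> p - q \<in> UG2_ideal r s"
  using ring.quotient_eq_iff_same_a_r_cos[OF ring_free_ring ideal_UG2_ideal, of p q]
  by (simp add: UG2_class_def minus_free_ring carrier_free_ring)

lemma UG2_class_simps:
  "UG2_class r s p \<otimes>\<^bsub>UG2 r s\<^esub> UG2_class r s q = UG2_class r s (p * q)"
  "UG2_class r s p \<oplus>\<^bsub>UG2 r s\<^esub> UG2_class r s q = UG2_class r s (p + q)"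
  "\<one>\<^bsub>UG2 r s\<^esub> = UG2_class r s 1"
  using ring_hom_mult[OF UG2_class_hom[of r s], of p q] ring_hom_add[OF UG2_class_hom[of r s], of p q]
    ring_hom_one[OF UG2_class_hom[of r s]]
  by (simp_all add: ring_of_type_algebra_def)

lemma UG2_class_closed: "UG2_class r s p \<in> carrier (UG2 r s)"
  using ring_hom_closed[OF UG2_class_hom[of r s], of p] by (simp add: ring_of_type_algebra_def)

lemma UG2_class_power: "UG2_class r s p [^]\<^bsub>UG2 r s\<^esub> n = UG2_class r s (p ^ n)" for n :: nat
proof -
  interpret ring "UG2 r s" by (rule ring_UG2)
  show ?thesis
    by (induction n) (simp_all add: UG2_class_simps power_commutes)
qed

lemma UG2_class_diff: "UG2_class r s p \<ominus>\<^bsub>UG2 r s\<^esub> UG2_class r s q = UG2_class r s (p - q)"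
proof -
  interpret ring "UG2 r s" by (rule ring_UG2)
  have "UG2_class r s (p - q) \<oplus>\<^bsub>UG2 r s\<^esub> UG2_class r s q = UG2_class r s p"
    by (simp add: UG2_class_simps)
  then show ?thesis using UG2_class_closed by (metis minus_closed r_neg2 a_comm a_minus_def add.inv_closed add.inv_solve_right)
qed

lemma UG2_class_carrier: "carrier (UG2 r s) = range (UG2_class r s)"
  by (auto simp: UG2_def UG2_class_def FactRing_def A_RCOSETS_def' ring_of_type_algebra_def)

lemma UG2_class_central_iff:
  "UG2_class r s z \<in> ring_center (UG2 r s) \<longleftrightarrow> (\<forall>p. z * p - p * z \<in> UG2_ideal r s)"
  by (auto simp: ring_center_def UG2_class_carrier UG2_class_simps UG2_class_eq_iff)

text \<open>The elements commuting with \<open>z\<close> modulo the ideal are closed under sums and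
  products and contain the scalars, hence all words and their combinations.\<close>

lemma UG2_class_central:
  fixes z :: "(gen, 'k::field) free_alg"
  assumes "\<And>x. z * var x - var x * z \<in> UG2_ideal r s"
  shows "UG2_class r s z \<in> ring_center (UG2 r s)"
  unfolding UG2_class_central_iff
proof
  note I = two_sided_idealD[OF two_sided_ideal_UG2_ideal[of r s]]
  let ?C = "\<lambda>p. z * p - p * z \<in> UG2_ideal r s"
  have mult: "?C (p * q)" if "?C p" "?C q" for p q
  proof -
    have "z * (p * q) - p * q * z = (z * p - p * z) * q + p * (z * q - q * z)"
      by (simp add: algebra_simps)
    then show ?thesis using that I by simp
  qed
  have add: "?C (p + q)" if "?C p" "?C q" for p q
  proof -
    have "z * (p + q) - (p + q) * z = (z * p - p * z) + (z * q - q * z)"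
      by (simp add: algebra_simps)
    then show ?thesis using that I by simp
  qed
  have const: "?C (Poly_Mapping.single 0 c)" for c
    by (simp add: single_0_central I)
  have word: "?C (Poly_Mapping.single (Free_Mon xs) 1)" for xs
  proof (induction xs)
    case Nil
    show ?case by (simp add: I flip: zero_free_mon_def)
  next
    case (Cons x xs)
    have "Poly_Mapping.single (Free_Mon (x # xs)) (1::'k) = var x * Poly_Mapping.single (Free_Mon xs) 1"
      by (simp add: var_def mult_single)
    then show ?case using mult[OF assms Cons] by simp
  qed
  fix p :: "(gen, 'k) free_alg"
  show "?C p"
  proof (induction p rule: poly_mapping_single_induct)
    case zero
    then show ?case by (simp add: I)
  next
    case (single_add p m c)
    obtain xs where "m = Free_Mon xs" by (cases m)
    then have "Poly_Mapping.single m c = Poly_Mapping.single 0 c * Poly_Mapping.single (Free_Mon xs) 1"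
      by (simp add: mult_single)
    then show ?case using add[OF single_add mult[OF const word]] by simp
  qed
qed

section \<open>The quantum group\<close>

lemma kalg_scale_quots: "kalg (scale_quots :: 'k::field \<Rightarrow> ('x, 'k) free_alg quots \<Rightarrow> _)"
proof
  fix c d :: 'k and x y :: "('x, 'k) free_alg quots"
  show "scale_quots c (x + y) = scale_quots c x + scale_quots c y"
    by (simp add: scale_quots_def distrib_left)
  show "scale_quots (c + d) x = scale_quots c x + scale_quots d x"
    by (simp add: scale_quots_def distrib_right single_add const_quots_hom)
  have "const_quots (Poly_Mapping.single 0 (c * d)) =
      const_quots (Poly_Mapping.single 0 c) * const_quots (Poly_Mapping.single (0::'x free_mon) d)"
    by (simp add: mult_single flip: const_quots_hom)
  then show "scale_quots c (scale_quots d x) = scale_quots (c * d) x"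
    by (simp add: scale_quots_def mult.assoc)
  show "scale_quots 1 x = x"
    by (simp add: scale_quots_def const_quots_hom)
  show "scale_quots c x * y = scale_quots c (x * y)"
    by (simp add: scale_quots_def mult.assoc)
  show "x * scale_quots c y = scale_quots c (x * y)"
    using const_quots_central[OF single_0_central, of c x]
    by (simp add: scale_quots_def flip: mult.assoc)
qed


text \<open>\<open>u\<close> stands for the image of the unit, which acts as an identity on
  \<open>x\<close> without being \<open>1\<close>.\<close>

lemma (in kalg) conjugation_twist:
  assumes "w * v = u" "v * w = u" "x * u = x" "u * x = x" "w * x * v = c \<bullet> x" "c \<noteq> 0"
  shows "w * x = c \<bullet> (x * w)" "v * x = inverse c \<bullet> (x * v)"
proof -
  have "w * x = w * x * v * w" using assms(2,3) by (simp add: mult.assoc)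
  then show "w * x = c \<bullet> (x * w)" using assms(5) by (simp add: scale_mult_left)
  have "x * v = v * (w * x * v)" using assms(2,4) by (simp flip: mult.assoc)
  then have "x * v = c \<bullet> (v * x)" using assms(5) by (simp add: scale_mult_right)
  then show "v * x = inverse c \<bullet> (x * v)" using assms(6) by simp
qed

locale UG2_parameters =
  fixes r s :: "'k::field"
  assumes nz: "r \<noteq> 0" "s \<noteq> 0" and generic: "r ^ 3 \<noteq> s ^ 3" "r ^ 4 \<noteq> s ^ 4" "r ^ 2 - r * s + s ^ 2 \<noteq> 0"
begin

abbreviation \<phi> :: "(gen, 'k) free_alg \<Rightarrow> (gen, 'k) free_alg quots" where
  "\<phi> \<equiv> at_ideal (UG2_ideal r s)"

abbreviation gen_img :: "gen \<Rightarrow> (gen, 'k) free_alg quots" where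
  "gen_img x \<equiv> \<phi> (var x)"

sublocale kalg "scale_quots :: 'k \<Rightarrow> (gen, 'k) free_alg quots \<Rightarrow> _"
  by (rule kalg_scale_quots)

sublocale O: kalg "scale_opp (scale_quots :: 'k \<Rightarrow> (gen, 'k) free_alg quots \<Rightarrow> _)"
  by (rule kalg_opp[OF kalg_scale_quots])

lemmas \<phi>_simps = at_ideal_add at_ideal_diff at_ideal_mult at_ideal_scale at_ideal_power at_ideal_0

lemma \<phi>_eq_iff: "\<phi> p = \<phi> q \<longleftrightarrow> p - q \<in> UG2_ideal r s"
  by (rule at_ideal_eq_iff[OF two_sided_ideal_UG2_ideal])

lemma \<phi>_rel:
  assumes "p \<in> rels_G1 \<union> rels_G2 r s \<union> rels_G3 r s \<union> rels_G4 r s \<union> rels_G5 r s \<union> rels_G6 r s"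
  shows "\<phi> p = 0"
proof -
  have "p \<in> UG2_ideal r s"
    using ring.genideal_self[OF ring_free_ring] assms unfolding UG2_ideal_def
    by (metis carrier_free_ring subset_UNIV subset_iff)
  then show ?thesis using \<phi>_eq_iff[of p 0] by (simp add: at_ideal_0)
qed

lemma torus_commute:
  assumes "x \<in> torus_gens" "y \<in> torus_gens"
  shows "gen_img x * gen_img y = gen_img y * gen_img x"
  using \<phi>_rel[of "var x * var y - var y * var x"] assms
  by (auto simp: rels_G1_def \<phi>_simps)

lemma unit_img: "\<phi> 1 * \<phi> p = \<phi> p" "\<phi> p * \<phi> 1 = \<phi> p"
  by (simp_all flip: at_ideal_mult)

lemma W_inv:
  "gen_img (W i) * gen_img (Winv i) = \<phi> 1" "gen_img (Winv i) * gen_img (W i) = \<phi> 1"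
  "gen_img (W' i) * gen_img (W'inv i) = \<phi> 1" "gen_img (W'inv i) * gen_img (W' i) = \<phi> 1"
proof -
  show W: "gen_img (W i) * gen_img (Winv i) = \<phi> 1" "gen_img (W' i) * gen_img (W'inv i) = \<phi> 1"
    using \<phi>_rel[of "var (W i) * var (Winv i) - 1"] \<phi>_rel[of "var (W' i) * var (W'inv i) - 1"]
    by (auto simp: rels_G1_def \<phi>_simps)
  show "gen_img (Winv i) * gen_img (W i) = \<phi> 1" "gen_img (W'inv i) * gen_img (W' i) = \<phi> 1"
    using W torus_commute[of "Winv i" "W i"] torus_commute[of "W'inv i" "W' i"]
    by (simp_all add: torus_gens_def)
qed

lemma conj_rels:
  "gen_img (W j) * gen_img (E i) * gen_img (Winv j) = scale_quots (pairing r s i j) (gen_img (E i))"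
  "gen_img (W j) * gen_img (F i) * gen_img (Winv j) = scale_quots (inverse (pairing r s i j)) (gen_img (F i))"
  "gen_img (W' j) * gen_img (E i) * gen_img (W'inv j) = scale_quots (inverse (pairing r s j i)) (gen_img (E i))"
  "gen_img (W' j) * gen_img (F i) * gen_img (W'inv j) = scale_quots (pairing r s j i) (gen_img (F i))"
proof -
  have "\<phi> (var (W j) * var (E i) * var (Winv j) - pairing r s i j \<cdot> var (E i)) = 0"
    "\<phi> (var (W j) * var (F i) * var (Winv j) - inverse (pairing r s i j) \<cdot> var (F i)) = 0"
    by (rule \<phi>_rel, auto simp: rels_G2_def)+
  then show "gen_img (W j) * gen_img (E i) * gen_img (Winv j) = scale_quots (pairing r s i j) (gen_img (E i))"
    "gen_img (W j) * gen_img (F i) * gen_img (Winv j) = scale_quots (inverse (pairing r s i j)) (gen_img (F i))"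
    by (simp_all add: \<phi>_simps)
  have "\<phi> (var (W' j) * var (E i) * var (W'inv j) - inverse (pairing r s j i) \<cdot> var (E i)) = 0"
    "\<phi> (var (W' j) * var (F i) * var (W'inv j) - pairing r s j i \<cdot> var (F i)) = 0"
    by (rule \<phi>_rel, auto simp: rels_G3_def)+
  then show "gen_img (W' j) * gen_img (E i) * gen_img (W'inv j) = scale_quots (inverse (pairing r s j i)) (gen_img (E i))"
    "gen_img (W' j) * gen_img (F i) * gen_img (W'inv j) = scale_quots (pairing r s j i) (gen_img (F i))"
    by (simp_all add: \<phi>_simps)
qed

lemmas pairing_nz' = pairing_nz[OF nz] pairing_nz[OF nz, THEN nonzero_imp_inverse_nonzero]

text \<open>Later cited by position: \<open>W\<close> on \<open>E\<close>, \<open>W\<close> on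
  \<open>F\<close>, \<open>W'\<close> on \<open>E\<close>, \<open>W'\<close> on \<open>F\<close>,
  each followed by the fact for the inverse generator.\<close>

lemmas twists =
  conjugation_twist[OF W_inv(1,2) unit_img(2,1) conj_rels(1) pairing_nz'(1)]
  conjugation_twist[OF W_inv(1,2) unit_img(2,1) conj_rels(2) pairing_nz'(2)]
  conjugation_twist[OF W_inv(3,4) unit_img(2,1) conj_rels(3) pairing_nz'(2)]
  conjugation_twist[OF W_inv(3,4) unit_img(2,1) conj_rels(4) pairing_nz'(1)]

lemma E_F: "gen_img (E i) * gen_img (F j) = gen_img (F j) * gen_img (E i) +
   (if i = j then scale_quots (inverse (param r i - param s i)) (gen_img (W i) - gen_img (W' i)) else 0)"
proof -
  have "\<phi> (var (E i) * var (F j) - var (F j) * var (E i)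
        - (if i = j then inverse (param r i - param s i) \<cdot> (var (W i) - var (W' i)) else 0)) = 0"
    by (rule \<phi>_rel) (auto simp: rels_G4_def)
  then show ?thesis by (simp add: \<phi>_simps algebra_simps split: if_splits)
qed

lemma scale_opp_to_opp: "scale_opp scale_quots c (to_opp x) = to_opp (scale_quots c x)"
  by (simp add: to_opp_scale)

lemma twist_opp:
  fixes w x :: "(gen, 'k) free_alg quots"
  assumes "w * x = scale_quots c (x * w)" "c * c' = 1"
  shows "to_opp w * to_opp x = scale_opp scale_quots c' (to_opp x * to_opp w)"
proof -
  have "c' * c = 1" using assms(2) by (simp add: mult.commute)
  then have "x * w = scale_quots c' (w * x)" using assms(1) by simp
  then show ?thesis by (simp only: scale_opp_to_opp flip: to_opp_mult)
qed

sublocale E: UG2_relations scale_quots r s "\<lambda>i. gen_img (E i)" "\<lambda>i. gen_img (F i)" "\<lambda>i. gen_img (W i)" "\<lambda>i. gen_img (W' i)"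
proof (unfold_locales; (intro nz generic twists E_F)?)
  let ?e1 = "var (E I1)" and ?e2 = "var (E I2)"
  have "\<phi> (?e2^2 * ?e1 - (inverse (r^3) + inverse (s^3)) \<cdot> (?e2 * ?e1 * ?e2)
        + inverse ((r * s)^3) \<cdot> (?e1 * ?e2^2)) = 0"
    by (rule \<phi>_rel) (auto simp: rels_G5_def Let_def)
  then show "(gen_img (E I2))\<^sup>2 * gen_img (E I1) -
    scale_quots (inverse (r ^ 3) + inverse (s ^ 3)) (gen_img (E I2) * gen_img (E I1) * gen_img (E I2)) +
    scale_quots (inverse ((r * s) ^ 3)) (gen_img (E I1) * (gen_img (E I2))\<^sup>2) = 0"
    by (simp add: \<phi>_simps)
  have "\<phi> (?e1^4 * ?e2 - ((r + s) * (r^2 + s^2)) \<cdot> (?e1^3 * ?e2 * ?e1)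
        + (r * s * (r^2 + s^2) * (r^2 + r * s + s^2)) \<cdot> (?e1^2 * ?e2 * ?e1^2)
        - ((r * s)^3 * (r + s) * (r^2 + s^2)) \<cdot> (?e1 * ?e2 * ?e1^3)
        + (r * s)^6 \<cdot> (?e2 * ?e1^4)) = 0"
    by (rule \<phi>_rel) (auto simp: rels_G5_def Let_def)
  then show "gen_img (E I1) ^ 4 * gen_img (E I2) -
    scale_quots ((r + s) * (r\<^sup>2 + s\<^sup>2)) (gen_img (E I1) ^ 3 * gen_img (E I2) * gen_img (E I1)) +
    scale_quots (r * s * (r\<^sup>2 + s\<^sup>2) * (r\<^sup>2 + r * s + s\<^sup>2)) ((gen_img (E I1))\<^sup>2 * gen_img (E I2) * (gen_img (E I1))\<^sup>2) -
    scale_quots ((r * s) ^ 3 * (r + s) * (r\<^sup>2 + s\<^sup>2)) (gen_img (E I1) * gen_img (E I2) * gen_img (E I1) ^ 3) +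
    scale_quots ((r * s) ^ 6) (gen_img (E I2) * gen_img (E I1) ^ 4) = 0"
    by (simp add: \<phi>_simps)
qed

text \<open>Reversing products, exchanging \<open>r\<close> with \<open>s\<close>, \<open>e\<^sub>i\<close> with \<open>f\<^sub>i\<close> and \<open>\<omega>\<^sub>i\<close> with
  \<open>\<omega>\<^sub>i'\<close> preserves the relations.\<close>

sublocale F: UG2_relations "scale_opp scale_quots" s r "\<lambda>i. to_opp (gen_img (F i))" "\<lambda>i. to_opp (gen_img (E i))"
  "\<lambda>i. to_opp (gen_img (W' i))" "\<lambda>i. to_opp (gen_img (W i))"
proof
  \<comment> \<open>Exchanging \<open>r\<close> and \<open>s\<close> inverts the transposed pairing,
    which compensates the inversion of twists by the reversed product.\<close>
  have pairing_swap: "pairing r s j i * pairing s r i j = 1" for i j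
    using nz by (cases i; cases j) (simp_all add: field_simps)
  fix i j
  show "to_opp (gen_img (W' j)) * to_opp (gen_img (F i)) =
      scale_opp scale_quots (pairing s r i j) (to_opp (gen_img (F i)) * to_opp (gen_img (W' j)))"
    by (rule twist_opp[OF twists(7) pairing_swap])
  show "to_opp (gen_img (W j)) * to_opp (gen_img (F i)) =
      scale_opp scale_quots (inverse (pairing s r j i)) (to_opp (gen_img (F i)) * to_opp (gen_img (W j)))"
    by (rule twist_opp[OF twists(3)]) (simp add: pairing_swap flip: inverse_mult_distrib)
  \<comment> \<open>This sign is absorbed by exchanging \<open>W\<close> and \<open>W'\<close> in
    the difference.\<close>
  have "inverse (param s i - param r i) = - inverse (param r i - param s i)"
    by (metis inverse_minus_eq minus_diff_eq)
  then show "to_opp (gen_img (F i)) * to_opp (gen_img (E j)) = to_opp (gen_img (E j)) * to_opp (gen_img (F i)) +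
      (if i = j then scale_opp scale_quots (inverse (param s i - param r i)) (to_opp (gen_img (W' i)) - to_opp (gen_img (W i))) else 0)"
    using E_F[of j i]
    by (auto simp: scale_opp_to_opp scale_minus_left scale_right_diff_distrib simp flip: to_opp_mult to_opp_add to_opp_diff)
next
  let ?f1 = "var (F I1)" and ?f2 = "var (F I2)"
  have "\<phi> (?f1 * ?f2^2 - (inverse (r^3) + inverse (s^3)) \<cdot> (?f2 * ?f1 * ?f2)
        + inverse ((r * s)^3) \<cdot> (?f2^2 * ?f1)) = 0"
    by (rule \<phi>_rel) (auto simp: rels_G6_def Let_def)
  then show "(to_opp (gen_img (F I2)))\<^sup>2 * to_opp (gen_img (F I1)) -
    scale_opp scale_quots (inverse (s ^ 3) + inverse (r ^ 3)) (to_opp (gen_img (F I2)) * to_opp (gen_img (F I1)) * to_opp (gen_img (F I2))) +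
    scale_opp scale_quots (inverse ((s * r) ^ 3)) (to_opp (gen_img (F I1)) * (to_opp (gen_img (F I2)))\<^sup>2) = 0"
    by (simp add: scale_opp_to_opp \<phi>_simps ac_simps flip: to_opp_mult to_opp_add to_opp_diff to_opp_power to_opp_0)
  have "\<phi> (?f2 * ?f1^4 - ((r + s) * (r^2 + s^2)) \<cdot> (?f1 * ?f2 * ?f1^3)
        + (r * s * (r^2 + s^2) * (r^2 + r * s + s^2)) \<cdot> (?f1^2 * ?f2 * ?f1^2)
        - ((r * s)^3 * (r + s) * (r^2 + s^2)) \<cdot> (?f1^3 * ?f2 * ?f1)
        + (r * s)^6 \<cdot> (?f1^4 * ?f2)) = 0"
    by (rule \<phi>_rel) (auto simp: rels_G6_def Let_def)
  then show "to_opp (gen_img (F I1)) ^ 4 * to_opp (gen_img (F I2)) -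
    scale_opp scale_quots ((s + r) * (s\<^sup>2 + r\<^sup>2)) (to_opp (gen_img (F I1)) ^ 3 * to_opp (gen_img (F I2)) * to_opp (gen_img (F I1))) +
    scale_opp scale_quots (s * r * (s\<^sup>2 + r\<^sup>2) * (s\<^sup>2 + s * r + r\<^sup>2))
      ((to_opp (gen_img (F I1)))\<^sup>2 * to_opp (gen_img (F I2)) * (to_opp (gen_img (F I1)))\<^sup>2) -
    scale_opp scale_quots ((s * r) ^ 3 * (s + r) * (s\<^sup>2 + r\<^sup>2)) (to_opp (gen_img (F I1)) * to_opp (gen_img (F I2)) * to_opp (gen_img (F I1)) ^ 3) +
    scale_opp scale_quots ((s * r) ^ 6) (to_opp (gen_img (F I2)) * to_opp (gen_img (F I1)) ^ 4) = 0"
    by (simp add: scale_opp_to_opp \<phi>_simps ac_simps flip: to_opp_mult to_opp_add to_opp_diff to_opp_power to_opp_0)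
qed (use nz generic in \<open>auto simp: algebra_simps\<close>)

lemma \<phi>_E_rep: "\<phi> (E_rep r s \<alpha>) = E.root \<alpha>"
  by (cases \<alpha>) (simp_all add: E12_rep_def E112_rep_def E1112_rep_def E11212_rep_def \<phi>_simps bracket_def)

lemma \<phi>_F_rep: "to_opp (\<phi> (F_rep r s \<alpha>)) = F.root \<alpha>"
  by (cases \<alpha>)
    (simp_all add: F12_rep_def F112_rep_def F1112_rep_def F11212_rep_def \<phi>_simps O.bracket_def
      scale_opp_to_opp mult.commute[of s "r^2"] mult.commute[of "s^2" r] flip: to_opp_mult to_opp_diff)

lemma UG2_class_central':
  assumes "\<And>x. \<phi> z * gen_img x = gen_img x * \<phi> z"
  shows "UG2_class r s z \<in> ring_center (UG2 r s)"
  using assms by (intro UG2_class_central) (simp flip: at_ideal_mult add: \<phi>_eq_iff)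

section \<open>Centrality of the \<open>l\<close>-th powers\<close>

context
  fixes l :: nat
  assumes l: "l > 0" "r ^ l = 1" "s ^ l = 1"
begin

lemma pairing_power: "pairing r s i j ^ l = 1" "inverse (pairing r s i j) ^ l = 1"
proof -
  have "(r ^ 3) ^ l = 1" "(s ^ 3) ^ l = 1"
    using l by (metis mult.commute power_mult power_one)+
  then show "pairing r s i j ^ l = 1" 
    using l by (cases i; cases j) (simp_all add: power_mult_distrib power_inverse)
  then show "inverse (pairing r s i j) ^ l = 1" by (simp add: power_inverse)
qed

lemma torus_twist:
  assumes "x \<in> torus_gens"
  shows "\<exists>p. gen_img x * gen_img (E i) = scale_quots p (gen_img (E i) * gen_img x) \<and> p ^ l = 1"
    and "\<exists>p. gen_img x * gen_img (F i) = scale_quots p (gen_img (F i) * gen_img x) \<and> p ^ l = 1"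
proof -
  note tw = twists[unfolded inverse_inverse_eq]
  consider j where "x = W j" | j where "x = Winv j" | j where "x = W' j" | j where "x = W'inv j"
    using assms unfolding torus_gens_def by auto
  then show "\<exists>p. gen_img x * gen_img (E i) = scale_quots p (gen_img (E i) * gen_img x) \<and> p ^ l = 1"
    by cases (use tw(1,2,5,6) pairing_power in blast)+
  from \<open>x \<in> torus_gens\<close>
  consider j where "x = W j" | j where "x = Winv j" | j where "x = W' j" | j where "x = W'inv j"
    unfolding torus_gens_def by auto
  then show "\<exists>p. gen_img x * gen_img (F i) = scale_quots p (gen_img (F i) * gen_img x) \<and> p ^ l = 1"
    by cases (use tw(3,4,7,8) pairing_power in blast)+
qed

lemma gen_cases:
  obtains i where "x = E i" | i where "x = F i" | "x \<in> torus_gens"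
  unfolding torus_gens_def by (cases x) auto

lemma E_root_central: "E_root r s \<alpha> [^]\<^bsub>UG2 r s\<^esub> l \<in> ring_center (UG2 r s)"
  unfolding E_root_def UG2_class_power
proof (rule UG2_class_central')
  fix x
  have "E.root \<alpha> ^ l * gen_img x = gen_img x * E.root \<alpha> ^ l"
  proof (cases x rule: gen_cases)
    case 3
    show ?thesis
      using torus_twist(1)[OF 3, of I1] torus_twist(1)[OF 3, of I2] root_vec_twist by blast
  qed (use E.root_power_commutes[OF l] in auto)
  then show "\<phi> (E_rep r s \<alpha> ^ l) * gen_img x = gen_img x * \<phi> (E_rep r s \<alpha> ^ l)"
    using l by (simp add: at_ideal_power \<phi>_E_rep)
qed

lemma F_root_central: "F_root r s \<alpha> [^]\<^bsub>UG2 r s\<^esub> l \<in> ring_center (UG2 r s)"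
  unfolding F_root_def UG2_class_power
proof (rule UG2_class_central')
  fix x
  have "F.root \<alpha> ^ l * to_opp (gen_img x) = to_opp (gen_img x) * F.root \<alpha> ^ l"
  proof (cases x rule: gen_cases)
    case 3
    have "\<exists>q. to_opp (gen_img x) * to_opp (gen_img (F i)) =
        scale_opp scale_quots q (to_opp (gen_img (F i)) * to_opp (gen_img x)) \<and> q ^ l = 1" for i
    proof -
      obtain p where p: "gen_img x * gen_img (F i) = scale_quots p (gen_img (F i) * gen_img x)" "p ^ l = 1"
        using torus_twist(2)[OF 3] by blast
      moreover have "p \<noteq> 0" using p(2) l(1) by (auto simp: power_0_left)
      ultimately have "p * inverse p = 1" "inverse p ^ l = 1"
        by (simp_all add: power_inverse)
      then show ?thesis using twist_opp[OF p(1)] by blast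
    qed
    from this[of I1] this[of I2] show ?thesis using O.root_vec_twist by blast
  qed (use F.root_power_commutes[OF l(1,3,2)] in auto)
  then show "\<phi> (F_rep r s \<alpha> ^ l) * gen_img x = gen_img x * \<phi> (F_rep r s \<alpha> ^ l)"
    using l by (simp add: at_ideal_power to_opp_inject' flip: \<phi>_F_rep to_opp_power to_opp_mult)
qed

lemma torus_power_central:
  assumes "x \<in> torus_gens"
  shows "UG2_class r s (var x) [^]\<^bsub>UG2 r s\<^esub> l \<ominus>\<^bsub>UG2 r s\<^esub> \<one>\<^bsub>UG2 r s\<^esub> \<in> ring_center (UG2 r s)"
  unfolding UG2_class_power UG2_class_simps UG2_class_diff
proof (rule UG2_class_central')
  fix y
  have "gen_img x ^ l * gen_img y = gen_img y * gen_img x ^ l"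
  proof (cases y rule: gen_cases)
    case (1 i)
    show ?thesis using torus_twist(1)[OF assms, of i] power_commute_twist(2) unfolding 1 by blast
  next
    case (2 i)
    show ?thesis using torus_twist(2)[OF assms, of i] power_commute_twist(2) unfolding 2 by blast
  next
    case 3
    then show ?thesis using torus_commute[OF assms] by (simp add: power_commuting_commutes)
  qed
  then show "\<phi> (var x ^ l - 1) * gen_img y = gen_img y * \<phi> (var x ^ l - 1)"
    using l by (simp add: at_ideal_diff at_ideal_power left_diff_distrib right_diff_distrib unit_img)
qed

end

end

theorem theorem3p2:
  fixes r s :: "'k :: field_char_0" and d d' l :: nat
  assumes "primitive_root_of_unity d r"
    and "primitive_root_of_unity d' s"
    and "l = lcm d d'"
    and "\<exists>z :: 'k. primitive_root_of_unity l z"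
    and "r ^ 3 \<noteq> s ^ 3"
    and "r ^ 4 \<noteq> s ^ 4"
    and "r ^ 2 - r * s + s ^ 2 \<noteq> 0"
  shows "(\<forall>\<alpha>. E_root r s \<alpha> [^]\<^bsub>UG2 r s\<^esub> l \<in> ring_center (UG2 r s)) \<and>
         (\<forall>\<alpha>. F_root r s \<alpha> [^]\<^bsub>UG2 r s\<^esub> l \<in> ring_center (UG2 r s)) \<and>
         (\<forall>k. omega r s k [^]\<^bsub>UG2 r s\<^esub> l \<ominus>\<^bsub>UG2 r s\<^esub> \<one>\<^bsub>UG2 r s\<^esub> \<in> ring_center (UG2 r s)) \<and>
         (\<forall>k. omega' r s k [^]\<^bsub>UG2 r s\<^esub> l \<ominus>\<^bsub>UG2 r s\<^esub> \<one>\<^bsub>UG2 r s\<^esub> \<in> ring_center (UG2 r s))"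
proof -
  have d: "d > 0" "r ^ d = 1" "d' > 0" "s ^ d' = 1"
    using assms(1,2) by (auto simp: primitive_root_of_unity_def)
  have l: "l > 0" "r ^ l = 1" "s ^ l = 1"
  proof -
    show "l > 0" using d assms(3) by (simp add: lcm_pos_nat)
    have "d dvd l" "d' dvd l" using assms(3) by auto
    then show "r ^ l = 1" "s ^ l = 1" using d by (metis dvd_def power_mult power_one)+
  qed
  interpret UG2_parameters r s
    using d assms(5-7) by unfold_locales (auto simp: power_0_left)
  show ?thesis
    using E_root_central[OF l] F_root_central[OF l] torus_power_central[OF l]
    by (auto simp: omega_def omega'_def torus_gens_def)
qed

end
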